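(* Let $D=X^4+16X^2+24X+9\in\mathbb Q[X]$, let $\sqrt D\in\mathbb Q((X^{-1}))$ be the square root with leading term $X^2$, and let $\alpha=(\sqrt D-3)/X$. Then $D$ is not Pellian, and there are infinitely many prime numbers $p$ such that the continued fraction of $\alpha$ has good reduction at $p$; in particular, for these $p$, every partial quotient $a_n$ of $\alpha$ has all its coefficients in $\mathbb Z_{(p)}$ (i.e. $p$ never divides a denominator of a coefficient of any $a_n$).
   Context: Laurent series: $\mathbb Q((X^{-1}))$, elements $\sum_{n\le N}t_nX^n$, with $\operatorname{ord}(\sum_{n\le N}t_nX^n)=-N$ if $t_N\ne0$; $\lfloor\beta\rfloor$ is the unique polynomial with $\operatorname{ord}(\beta-\lfloor\beta\rfloor)>0$. Continued fraction of $\alpha$: complete quotients $\alpha_0=\alpha$, $\alpha_{n+1}=1/(\alpha_n-\lfloor\alpha_n\rfloor)$, partial quotients $a_n=\lfloor\alpha_n\rfloor$. Good reduction at $p$ means: for all $n\ge0$, $\alpha_n$ has all coefficients in $\mathbb Z_{(p)}$ (the localisation of $\mathbb Z$ at $p$) and its coefficientwise reduction mod $p$ equals the $n$-th complete quotient of the reduction of $\alpha$ mod $p$ in $\mathbb F_p((X^{-1}))$. $D$ is Pellian if there exist $p,q\in\mathbb Q[X]$, $q\ne0$, with $p^2-Dq^2\in\mathbb Q^*$. *)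

theory Defs
  imports "HOL-Computational_Algebra.Computational_Algebra"
begin

text \<open>
  Convention: the field of Laurent series Q((X^-1)) is modelled by the library type
  rat fls of formal Laurent series in the variable T = X^-1 (finitely many negative
  powers of T = finitely many positive powers of X).  The coefficient of X^n of
  beta is  beta $$ (-n), and the library's fls_subdegree equals ord.
  The variable X itself is fls_X_inv.
\<close>

definition poly_ser :: "'a::comm_ring_1 poly \<Rightarrow> 'a fls" where
  "poly_ser P = (\<Sum>i\<le>degree P. fls_const (coeff P i) * fls_X_inv ^ i)"

(* beta - floor beta : keep only the terms X^n with n < 0, i.e. T-index > 0 *)
lift_definition fls_frac :: "'a::zero fls \<Rightarrow> 'a fls"
  is "\<lambda>f k. if k > 0 then f k else 0"
  by (simp add: eventually_mono)

definition fls_floor :: "'a::ab_group_add fls \<Rightarrow> 'a fls" where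
  "fls_floor b = b - fls_frac b"

primrec cq :: "'a::field fls \<Rightarrow> nat \<Rightarrow> 'a fls" where
  "cq a 0 = a"
| "cq a (Suc n) = inverse (fls_frac (cq a n))"

definition pq :: "'a::field fls \<Rightarrow> nat \<Rightarrow> 'a fls" where
  "pq a n = fls_floor (cq a n)"

definition pellian :: "rat poly \<Rightarrow> bool" where
  "pellian D \<longleftrightarrow> (\<exists>P Q. Q \<noteq> 0 \<and> (\<exists>c. c \<noteq> 0 \<and> P^2 - D * Q^2 = [:c:]))"

definition in_Zloc :: "int \<Rightarrow> rat \<Rightarrow> bool" where
  "in_Zloc p q \<longleftrightarrow> \<not> p dvd snd (quotient_of q)"

definition ser_in_Zloc :: "int \<Rightarrow> rat fls \<Rightarrow> bool" where
  "ser_in_Zloc p b \<longleftrightarrow> (\<forall>k. in_Zloc p (fls_nth b k))"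

(* Model of F_p((X^-1)): int fls whose coefficients lie in {0..<p}
   (the residues mod p); arithmetic is integer arithmetic followed by reduction mod p *)
lift_definition fls_mod :: "int \<Rightarrow> int fls \<Rightarrow> int fls"
  is "\<lambda>p f k. f k mod p"
  by (simp add: eventually_mono)

definition Fp_ser :: "int \<Rightarrow> int fls \<Rightarrow> bool" where
  "Fp_ser p g \<longleftrightarrow> (\<forall>k. 0 \<le> fls_nth g k \<and> fls_nth g k < p)"

definition Fp_inverse :: "int \<Rightarrow> int fls \<Rightarrow> int fls" where
  "Fp_inverse p f = (if f = 0 then 0 else THE g. Fp_ser p g \<and> fls_mod p (g * f) = 1)"

primrec cq_Fp :: "int \<Rightarrow> int fls \<Rightarrow> nat \<Rightarrow> int fls" where
  "cq_Fp p b 0 = b"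
| "cq_Fp p b (Suc n) = Fp_inverse p (fls_frac (cq_Fp p b n))"

definition red_rat :: "int \<Rightarrow> rat \<Rightarrow> int" where
  "red_rat p q = (if q = 0 then 0 else
     THE r. 0 \<le> r \<and> r < p \<and> (snd (quotient_of q) * r) mod p = fst (quotient_of q) mod p)"

lift_definition red_ser :: "int \<Rightarrow> rat fls \<Rightarrow> int fls"
  is "\<lambda>p f k. red_rat p (f k)"
  by (simp add: red_rat_def eventually_mono)

definition good_reduction :: "int \<Rightarrow> rat fls \<Rightarrow> bool" where
  "good_reduction p a \<longleftrightarrow>
     (\<forall>n. ser_in_Zloc p (cq a n) \<and> red_ser p (cq a n) = cq_Fp p (red_ser p a) n)"

end

theory Submission
  imports "HOL-Number_Theory.Residues" Defs
begin

text \<open>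
  The complete quotients of \<open>\<alpha>\<close> are \<open>(\<surd>D + X\<^sup>2 + c) / (u (X - v))\<close>, where \<open>(v, c + v\<^sup>2)\<close> runs
  through points of the elliptic curve \<open>y\<^sup>2 = D\<close> lying on the orbit \<open>R + nP\<close> of
  \<open>R = (0, - 3)\<close> under translation by \<open>P\<close>, the difference of the two points at infinity.  Good
  reduction at \<open>p\<close> fails only if some \<open>c\<close> becomes \<open>8\<close> modulo \<open>p\<close>, i.e. if the orbit meets
  infinity modulo \<open>p\<close>.  Over \<open>\<rat>(\<surd>2)\<close>, \<open>D\<close> has the factor
  \<open>F = X\<^sup>2 - \<surd>2 X + 9 + 6\<surd>2\<close>, and the class of \<open>F\<close> modulo squares is constant on the orbit (a
  2-descent).  It is the class of \<open>F(0) = 3 (1 + \<surd>2)\<^sup>2\<close> at \<open>R\<close>, and trivial at infinity.  So every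
  \<open>p\<close> works for which \<open>2\<close> is a square and \<open>3\<close> is not; we take \<open>p \<equiv> 3 mod 4\<close> with \<open>2\<close> and
  \<open>- 3\<close> squares, and get infinitely many from the norm form \<open>t\<^sup>4 + 2t\<^sup>2 + 25\<close> of \<open>\<surd>2 + \<surd>(-3)\<close>.

  A solution of the Pell equation would make the analogous orbit of multiples of \<open>P\<close> return to
  \<open>c = 8\<close>.  At the prime 2 the values \<open>c\<close> alternate between \<open>8 mod 64\<close> and non-integral ones, and a
  returning orbit is symmetric about a point of order two, where \<open>c\<close> is one of \<open>0, 9, -1\<close>:
  impossible in either case.
\<close>

section \<open>The localisation of the integers at a prime\<close>

lemma in_Zloc_iff:
  assumes "prime p"
  shows "in_Zloc p q \<longleftrightarrow> (\<exists>a b. \<not> p dvd b \<and> q = of_int a / of_int b)"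
proof
  assume "in_Zloc p q"
  then show "\<exists>a b. \<not> p dvd b \<and> q = of_int a / of_int b"
    unfolding in_Zloc_def using quotient_of_div[of q "fst (quotient_of q)" "snd (quotient_of q)"] by auto
next
  assume "\<exists>a b. \<not> p dvd b \<and> q = of_int a / of_int b"
  then obtain a b where ab: "\<not> p dvd b" "q = of_int a / of_int b" by blast
  obtain x y where xy: "quotient_of q = (x, y)" by fastforce
  have y: "y > 0" "coprime x y" "q = of_int x / of_int y"
    using quotient_of_denom_pos[OF xy] quotient_of_coprime[OF xy] quotient_of_div[OF xy] by auto
  have "b \<noteq> 0" using ab by auto
  then have "of_int (x * b) = (of_int (a * y) :: rat)"
    using y ab by (simp add: field_simps)
  then have "x * b = a * y" by linarith
  then have "y dvd b" using y(2) by (metis coprime_commute coprime_dvd_mult_right_iff dvd_triv_right)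
  then show "in_Zloc p q" unfolding in_Zloc_def using ab xy by (auto intro: dvd_trans)
qed

lemma in_Zloc_of_int [simp]: "prime p \<Longrightarrow> in_Zloc p (of_int k)"
  using in_Zloc_iff[of p "of_int k"] not_prime_unit[of p] by (metis div_by_1 of_int_1)

lemma in_Zloc_numeral [simp]:
  assumes "prime p"
  shows "in_Zloc p 0" "in_Zloc p 1" "in_Zloc p (numeral n)"
  using in_Zloc_of_int[OF assms, of 0] in_Zloc_of_int[OF assms, of 1]
    in_Zloc_of_int[OF assms, of "numeral n"] by simp_all

lemma in_Zloc_add:
  assumes "prime p" "in_Zloc p x" "in_Zloc p y" shows "in_Zloc p (x + y)"
proof -
  obtain a b c d where *: "\<not> p dvd b" "x = of_int a / of_int b" "\<not> p dvd d" "y = of_int c / of_int d"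
    using assms by (auto simp: in_Zloc_iff)
  have "b \<noteq> 0" "d \<noteq> 0" using * by auto
  then have "x + y = of_int (a * d + c * b) / of_int (b * d)" using * by (simp add: field_simps)
  moreover have "\<not> p dvd b * d" using * assms prime_dvd_mult_iff by blast
  ultimately show ?thesis using in_Zloc_iff[OF assms(1)] by blast
qed

lemma in_Zloc_mult:
  assumes "prime p" "in_Zloc p x" "in_Zloc p y" shows "in_Zloc p (x * y)"
proof -
  obtain a b c d where *: "\<not> p dvd b" "x = of_int a / of_int b" "\<not> p dvd d" "y = of_int c / of_int d"
    using assms by (auto simp: in_Zloc_iff)
  then have "x * y = of_int (a * c) / of_int (b * d)" by simp
  moreover have "\<not> p dvd b * d" using * assms prime_dvd_mult_iff by blast
  ultimately show ?thesis using in_Zloc_iff[OF assms(1)] by blast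
qed

lemma in_Zloc_minus: "prime p \<Longrightarrow> in_Zloc p x \<Longrightarrow> in_Zloc p (- x)"
  using in_Zloc_mult[of p "of_int (-1)" x] in_Zloc_of_int[of p "-1"] by simp

lemma in_Zloc_diff: "prime p \<Longrightarrow> in_Zloc p x \<Longrightarrow> in_Zloc p y \<Longrightarrow> in_Zloc p (x - y)"
  using in_Zloc_add[of p x "- y"] in_Zloc_minus[of p y] by simp

lemma in_Zloc_power: "prime p \<Longrightarrow> in_Zloc p x \<Longrightarrow> in_Zloc p (x ^ n)"
  by (induction n) (auto intro: in_Zloc_mult)

lemma in_Zloc_sum: "prime p \<Longrightarrow> (\<And>i. i \<in> I \<Longrightarrow> in_Zloc p (f i)) \<Longrightarrow> in_Zloc p (sum f I)"
  by (induction I rule: infinite_finite_induct) (auto intro: in_Zloc_add)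

lemmas in_Zloc_intros = in_Zloc_add in_Zloc_mult in_Zloc_minus in_Zloc_diff in_Zloc_power

section \<open>The maximal ideal of the local ring: congruences modulo \<open>p\<close>, and units
  as its complement\<close>

definition in_pZloc :: "int \<Rightarrow> rat \<Rightarrow> bool" where
  "in_pZloc p q \<longleftrightarrow> in_Zloc p (q / of_int p)"

lemma in_pZloc_add: "prime p \<Longrightarrow> in_pZloc p x \<Longrightarrow> in_pZloc p y \<Longrightarrow> in_pZloc p (x + y)"
  unfolding in_pZloc_def by (simp add: add_divide_distrib in_Zloc_add)

lemma in_pZloc_minus: "prime p \<Longrightarrow> in_pZloc p x \<Longrightarrow> in_pZloc p (- x)"
  unfolding in_pZloc_def using in_Zloc_minus[of p "x / of_int p"] by simp

lemma in_pZloc_diff: "prime p \<Longrightarrow> in_pZloc p x \<Longrightarrow> in_pZloc p y \<Longrightarrow> in_pZloc p (x - y)"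
  unfolding in_pZloc_def by (simp add: diff_divide_distrib in_Zloc_diff)

lemma in_pZloc_mult_left: "prime p \<Longrightarrow> in_Zloc p x \<Longrightarrow> in_pZloc p y \<Longrightarrow> in_pZloc p (x * y)"
  unfolding in_pZloc_def using in_Zloc_mult[of p x "y / of_int p"] by simp

lemma in_pZloc_mult_right: "prime p \<Longrightarrow> in_pZloc p x \<Longrightarrow> in_Zloc p y \<Longrightarrow> in_pZloc p (x * y)"
  using in_pZloc_mult_left[of p y x] by (simp add: mult.commute)

lemma in_pZloc_imp_in_Zloc: "prime p \<Longrightarrow> in_pZloc p x \<Longrightarrow> in_Zloc p x"
  unfolding in_pZloc_def using in_Zloc_mult[of p "of_int p" "x / of_int p"] by auto

lemma in_pZloc_frac_iff:
  assumes "prime p" "\<not> p dvd b"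
  shows "in_pZloc p (of_int a / of_int b) \<longleftrightarrow> p dvd a"
proof
  have p0: "p \<noteq> 0" and b0: "b \<noteq> 0" using assms by auto
  assume "in_pZloc p (of_int a / of_int b)"
  then obtain c d where cd: "\<not> p dvd d" "of_int a / of_int b / of_int p = (of_int c / of_int d :: rat)"
    unfolding in_pZloc_def in_Zloc_iff[OF assms(1)] by blast
  have d0: "d \<noteq> 0" using cd by auto
  have "(of_int (a * d) :: rat) = of_int (p * (b * c))" using cd(2) p0 b0 d0 by (simp add: field_simps)
  then have "a * d = p * (b * c)" by linarith
  then show "p dvd a" using cd(1) assms(1) by (metis dvd_triv_left prime_dvd_mult_iff)
next
  assume "p dvd a"
  then obtain k where "a = p * k" by blast
  then have "of_int a / of_int b / of_int p = (of_int k / of_int b :: rat)" using assms by auto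
  then show "in_pZloc p (of_int a / of_int b)"
    unfolding in_pZloc_def using in_Zloc_iff[OF assms(1)] assms(2) by metis
qed

lemma in_pZloc_of_int [simp]: "prime p \<Longrightarrow> in_pZloc p (of_int k) \<longleftrightarrow> p dvd k"
  using in_pZloc_frac_iff[of p 1 k] not_prime_unit[of p] by (simp del: zdvd1_eq)

lemma not_in_pZloc_1: "prime p \<Longrightarrow> \<not> in_pZloc p 1"
  using in_pZloc_of_int[of p 1] not_prime_unit[of p] by auto

lemma in_pZloc_numeral: "prime p \<Longrightarrow> in_pZloc p (numeral n) \<longleftrightarrow> p dvd numeral n"
  using in_pZloc_of_int[of p "numeral n"] by simp

lemma in_pZloc_0: "prime p \<Longrightarrow> in_pZloc p 0"
  using in_pZloc_of_int[of p 0] by simp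

lemma in_pZloc_sum: "prime p \<Longrightarrow> (\<And>i. i \<in> I \<Longrightarrow> in_pZloc p (f i)) \<Longrightarrow> in_pZloc p (sum f I)"
  by (induction I rule: infinite_finite_induct) (auto intro: in_pZloc_add in_pZloc_0)

lemma in_pZloc_mult_iff:
  assumes "prime p" "in_Zloc p x" "in_Zloc p y"
  shows "in_pZloc p (x * y) \<longleftrightarrow> in_pZloc p x \<or> in_pZloc p y"
proof -
  obtain a b c d where *: "\<not> p dvd b" "x = of_int a / of_int b" "\<not> p dvd d" "y = of_int c / of_int d"
    using assms by (auto simp: in_Zloc_iff)
  have bd: "\<not> p dvd b * d" using * assms prime_dvd_mult_iff by blast
  have "x * y = of_int (a * c) / of_int (b * d)" using * by simp
  then have "in_pZloc p (x * y) \<longleftrightarrow> p dvd a * c" using in_pZloc_frac_iff[OF assms(1) bd] by metis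
  then show ?thesis using * assms(1) by (simp add: in_pZloc_frac_iff prime_dvd_mult_iff)
qed

lemma in_pZloc_power_iff:
  assumes "prime p" "in_Zloc p x" "n > 0"
  shows "in_pZloc p (x ^ n) \<longleftrightarrow> in_pZloc p x"
  using assms(3)
proof (induction n)
  case (Suc n)
  then show ?case using assms in_pZloc_mult_iff[of p x "x ^ n"] in_Zloc_power[of p x n]
    by (cases n) auto
qed simp

lemma in_Zloc_inverse:
  assumes "prime p" "in_Zloc p x" "\<not> in_pZloc p x"
  shows "in_Zloc p (inverse x)"
proof -
  obtain a b where *: "\<not> p dvd b" "x = of_int a / of_int b"
    using assms by (auto simp: in_Zloc_iff)
  then have "\<not> p dvd a" using assms in_pZloc_frac_iff by blast
  moreover have "inverse x = of_int b / of_int a" using * by simp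
  ultimately show ?thesis using in_Zloc_iff[OF assms(1)] by blast
qed

lemma in_Zloc_divide:
  assumes "prime p" "in_Zloc p y" "in_Zloc p x" "\<not> in_pZloc p x"
  shows "in_Zloc p (y / x)"
  using in_Zloc_mult[OF assms(1,2) in_Zloc_inverse[OF assms(1,3,4)]] by (simp add: divide_inverse)

lemma in_pZloc_inverse:
  assumes "prime p" "\<not> in_Zloc p x"
  shows "in_pZloc p (inverse x)"
proof -
  obtain a b where ab: "quotient_of x = (a, b)" by fastforce
  have x: "x = of_int a / of_int b" "coprime a b"
    using quotient_of_div[OF ab] quotient_of_coprime[OF ab] by auto
  have "p dvd b" using assms ab unfolding in_Zloc_def by simp
  moreover have "\<not> p dvd a" using x(2) \<open>p dvd b\<close> assms(1)
    by (meson coprime_common_divisor not_prime_unit)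
  ultimately show ?thesis using in_pZloc_frac_iff[OF assms(1), of a b] x by simp
qed

text \<open>Modulo a prime that is 3 modulo 4, \<open>-1\<close> is not a square, so a unit
  \<open>x\<close> would give the impossible \<open>(y / x)^2 = -1\<close>.\<close>

lemma in_pZloc_sum_squares:
  assumes p: "prime p" "p mod 4 = 3"
    and xy: "in_Zloc p x" "in_Zloc p y" and s: "in_pZloc p (x\<^sup>2 + y\<^sup>2)"
  shows "in_pZloc p x"
proof (rule ccontr)
  assume nx: "\<not> in_pZloc p x"
  have "in_pZloc p (inverse (x\<^sup>2) * (x\<^sup>2 + y\<^sup>2))"
    using p s nx xy by (auto intro!: in_pZloc_mult_left in_Zloc_inverse in_Zloc_power simp: in_pZloc_power_iff)
  moreover have "x \<noteq> 0" using nx in_pZloc_0[OF p(1)] by auto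
  then have "inverse (x\<^sup>2) * (x\<^sup>2 + y\<^sup>2) = 1 + (y / x)\<^sup>2" by (simp add: field_simps)
  moreover have "in_Zloc p (y / x)" using p xy nx by (simp add: in_Zloc_divide)
  ultimately obtain a b where ab: "\<not> p dvd b" "in_pZloc p (1 + (of_int a / of_int b)\<^sup>2)"
    using p by (auto simp: in_Zloc_iff)
  have b0: "b \<noteq> 0" using ab by auto
  have "(1 + (of_int a / of_int b)\<^sup>2 :: rat) = of_int (b\<^sup>2 + a\<^sup>2) / of_int (b\<^sup>2)"
    using b0 by (simp add: field_simps)
  moreover have "\<not> p dvd b\<^sup>2" using ab p prime_dvd_power by blast
  ultimately have dvd: "p dvd b\<^sup>2 + a\<^sup>2" using ab in_pZloc_frac_iff[OF p(1)] by metis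
  have na: "\<not> p dvd a"
    using dvd \<open>\<not> p dvd b\<^sup>2\<close> dvd_add_left_iff[of p "a\<^sup>2" "b\<^sup>2"] by (auto simp: power2_eq_square)
  \<comment> \<open>Here \<open>p = 4 * m + 3\<close>, so \<open>(p - 1) div 2 = 2 * m + 1\<close>
    is odd; raising \<open>a^2 = - b^2\<close> to this power yields \<open>1 = -1\<close> by
    Fermat.\<close>
  define m where "m = nat (p div 4)"
  have p0: "p > 0" using p prime_gt_0_int by blast
  have np: "nat p - 1 = 2 * (2 * m + 1)" "prime (nat p)" and npp: "int (nat p) = p"
  proof -
    show "int (nat p) = p" using p0 by simp
    show "prime (nat p)" using p p0 by simp
    have "p = 4 * (p div 4) + 3" using p(2) by presburger
    then have "nat p = 4 * nat (p div 4) + 3" using p0 by linarith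
    then show "nat p - 1 = 2 * (2 * m + 1)" unfolding m_def by simp
  qed
  have fermat: "[c ^ (nat p - 1) = 1] (mod p)" if "\<not> p dvd c" for c
  proof -
    have "\<not> int (nat p) dvd int (nat \<bar>c\<bar>)" using that npp by simp
    then have "\<not> nat p dvd nat \<bar>c\<bar>" unfolding of_nat_dvd_iff .
    then have "[nat \<bar>c\<bar> ^ (nat p - 1) = 1] (mod nat p)"
      by (rule fermat_theorem[OF np(2)])
    then have "[int (nat \<bar>c\<bar> ^ (nat p - 1)) = int 1] (mod int (nat p))"
      unfolding cong_int_iff .
    then have "[int (nat \<bar>c\<bar>) ^ (nat p - 1) = 1] (mod int (nat p))" by simp
    moreover have "int (nat \<bar>c\<bar>) ^ (nat p - 1) = c ^ (nat p - 1)"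
      unfolding np(1) by (simp add: power_mult)
    ultimately show ?thesis using npp by simp
  qed
  have "[a\<^sup>2 = - (b\<^sup>2)] (mod p)" using dvd by (simp add: cong_iff_dvd_diff add.commute)
  then have "[(a\<^sup>2) ^ (2 * m + 1) = (- (b\<^sup>2)) ^ (2 * m + 1)] (mod p)" by (rule cong_pow)
  moreover have "(- (b\<^sup>2)) ^ (2 * m + 1) = - ((b\<^sup>2) ^ (2 * m + 1))" by (simp add: power_minus_odd)
  ultimately have "[a ^ (nat p - 1) = - (b ^ (nat p - 1))] (mod p)"
    unfolding np(1) power_mult by simp
  moreover have "[- (b ^ (nat p - 1)) = - 1] (mod p)"
    using fermat[OF ab(1)] by (simp add: cong_minus_minus_iff)
  ultimately have "[1 = - 1] (mod p)" using fermat[OF na] cong_sym cong_trans by blast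
  then have "p dvd 2" by (simp add: cong_iff_dvd_diff)
  then have "p \<le> 2" by (simp add: zdvd_imp_le)
  then have "p = 1 \<or> p = 2" using p0 by linarith
  then show False using p(2) by auto
qed

section \<open>Points on the curve and their reduction at good primes\<close>

definition quartic :: "rat \<Rightarrow> rat" where
  "quartic x = x^4 + 16 * x\<^sup>2 + 24 * x + 9"

text \<open>Chosen so that \<open>next_c c v + v^2 = - (c + v^2)\<close>: the parabola
  \<open>y = X^2 + next_c c v\<close> passes through the conjugate point of
  \<open>(v, c + v^2)\<close>.\<close>

definition next_c :: "rat \<Rightarrow> rat \<Rightarrow> rat" where
  "next_c c v = - c - 2 * v\<^sup>2"

text \<open>With \<open>c' = next_c c v\<close>, the difference \<open>D - (X^2 + c')^2\<close> is a
  quadratic with leading coefficient \<open>16 - 2 * c'\<close> and linear coefficient 24. One root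
  is \<open>v\<close>, and this is the other one; it escapes to infinity when
  \<open>c' = 8\<close>.\<close>

definition next_v :: "rat \<Rightarrow> rat \<Rightarrow> rat" where
  "next_v c v = 12 / (next_c c v - 8) - v"

definition on_curve :: "rat \<Rightarrow> rat \<Rightarrow> bool" where
  "on_curve c v \<longleftrightarrow> (c + v\<^sup>2)\<^sup>2 = quartic v"

primrec orbit :: "rat \<times> rat \<Rightarrow> nat \<Rightarrow> rat \<times> rat" where
  "orbit s 0 = s"
| "orbit s (Suc n) = (next_c (fst (orbit s n)) (snd (orbit s n)), next_v (fst (orbit s n)) (snd (orbit s n)))"

text \<open>The qualified method name is needed because HOL-Algebra shadows \<open>algebra\<close>.\<close>

lemma on_curve_quadratic:
  "on_curve c v \<longleftrightarrow> (16 - 2 * c) * v\<^sup>2 + 24 * v + 9 - c\<^sup>2 = 0"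
proof -
  have "(16 - 2 * c) * v\<^sup>2 + 24 * v + 9 - c\<^sup>2 = quartic v - (c + v\<^sup>2)\<^sup>2"
    unfolding quartic_def by Groebner_Basis.algebra
  then show ?thesis unfolding on_curve_def by auto
qed

lemma on_curve_next_c: "on_curve (next_c c v) v \<longleftrightarrow> on_curve c v"
proof -
  have "(next_c c v + v\<^sup>2)\<^sup>2 = (c + v\<^sup>2)\<^sup>2" unfolding next_c_def by Groebner_Basis.algebra
  then show ?thesis unfolding on_curve_def by simp
qed

text \<open>Vieta's formulas for the quadratic \<open>D - (X^2 + next_c c v)^2\<close>, whose second
  root is again the abscissa of a point on the curve.\<close>

lemma
  assumes "on_curve c v" "next_c c v \<noteq> 8"
  shows next_sum: "(16 - 2 * next_c c v) * (v + next_v c v) = -24"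
    and next_prod: "(16 - 2 * next_c c v) * (v * next_v c v) = 9 - (next_c c v)\<^sup>2"
    and on_curve_next: "on_curve (next_c c v) (next_v c v)"
proof -
  let ?c = "next_c c v" and ?v = "next_v c v"
  have "v + ?v = 12 / (?c - 8)" by (simp add: next_v_def)
  moreover have "k * (12 / k) = 12" if "k \<noteq> 0" for k :: rat using that by simp
  ultimately have "(?c - 8) * (v + ?v) = 12" using assms(2) by (metis right_minus_eq)
  moreover have "(16 - 2 * ?c) * (v + ?v) = - (2 * ((?c - 8) * (v + ?v)))"
    by (simp add: algebra_simps)
  ultimately show 1: "(16 - 2 * ?c) * (v + ?v) = -24" by (simp only:)
  have 2: "(16 - 2 * ?c) * v\<^sup>2 + 24 * v + 9 - ?c\<^sup>2 = 0"
    using assms(1) on_curve_next_c on_curve_quadratic by blast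
  show "(16 - 2 * ?c) * (v * ?v) = 9 - ?c\<^sup>2" using 1 2 by Groebner_Basis.algebra
  show "on_curve ?c ?v" unfolding on_curve_quadratic using 1 2 by Groebner_Basis.algebra
qed

text \<open>\<open>w\<close> and \<open>z\<close> are rational lifts of square roots of 2 and -3
  modulo \<open>p\<close>. As -1 is a non-square, so is 3.\<close>

locale good_prime =
  fixes p :: int and w z :: rat
  assumes prime: "prime p" and mod4: "p mod 4 = 3" and ne3: "p \<noteq> 3"
    and w: "in_Zloc p w" "in_pZloc p (w\<^sup>2 - 2)"
    and z: "in_Zloc p z" "in_pZloc p (z\<^sup>2 + 3)"
begin

definition qfactor :: "rat \<Rightarrow> rat" where
  "qfactor x = x\<^sup>2 - w * x + 9 + 6 * w"

lemmas loc = in_Zloc_intros[OF prime] in_Zloc_numeral[OF prime] w(1) z(1)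

lemma odd_prime: "p \<noteq> 2" using mod4 by auto

lemma unit_2: "\<not> in_pZloc p 2"
  using prime odd_prime primes_dvd_imp_eq[of p 2] by (auto simp: in_pZloc_numeral)

lemma unit_3: "\<not> in_pZloc p 3"
  using prime ne3 primes_dvd_imp_eq[of p 3] by (auto simp: in_pZloc_numeral)

lemma unit_24: "\<not> in_pZloc p 24"
proof -
  have "\<not> in_pZloc p (2 ^ 3 * 3)"
    using unit_2 unit_3 prime loc by (simp only: in_pZloc_mult_iff in_pZloc_power_iff) simp
  then show ?thesis by simp
qed

lemma qfactor_in_Zloc: "in_Zloc p v \<Longrightarrow> in_Zloc p (qfactor v)"
  unfolding qfactor_def by (intro loc)

text \<open>\<open>D = (X^2)^2 + (4 * X + 3)^2\<close> is a sum of two squares, so a zero modulo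
  \<open>p\<close> would make both \<open>v\<close> and \<open>4 * v + 3\<close> vanish, hence also
  3.\<close>

lemma quartic_unit:
  assumes v: "in_Zloc p v"
  shows "\<not> in_pZloc p (quartic v)"
proof
  assume "in_pZloc p (quartic v)"
  then have "in_pZloc p ((v\<^sup>2)\<^sup>2 + (4 * v + 3)\<^sup>2)"
    unfolding quartic_def by (simp add: algebra_simps power2_eq_square power4_eq_xxxx)
  then have s: "in_pZloc p (v\<^sup>2)" "in_pZloc p ((4 * v + 3)\<^sup>2 + (v\<^sup>2)\<^sup>2)"
    using v in_pZloc_sum_squares[OF prime mod4, of "v\<^sup>2" "4 * v + 3"]
    by (auto intro!: loc simp: add.commute)
  then have "in_pZloc p v" "in_pZloc p (4 * v + 3)"
    using v prime in_pZloc_power_iff[of p v 2] in_pZloc_sum_squares[OF prime mod4, of "4 * v + 3" "v\<^sup>2"]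
    by (auto intro!: loc)
  then have "in_pZloc p ((4 * v + 3) - 4 * v)"
    using prime by (intro in_pZloc_diff in_pZloc_mult_left loc)
  then show False using unit_3 by simp
qed

text \<open>With \<open>w = \<surd>2\<close>, \<open>qfactor v\<close> and its conjugate multiply to \<open>quartic v\<close>.\<close>

lemma qfactor_unit:
  assumes v: "in_Zloc p v"
  shows "\<not> in_pZloc p (qfactor v)"
proof
  assume "in_pZloc p (qfactor v)"
  then have "in_pZloc p (qfactor v * (v\<^sup>2 + w * v + 9 - 6 * w) + (w\<^sup>2 - 2) * (v - 6)\<^sup>2)"
    using prime v w by (intro in_pZloc_add in_pZloc_mult_right loc)
  moreover have "qfactor v * (v\<^sup>2 + w * v + 9 - 6 * w) + (w\<^sup>2 - 2) * (v - 6)\<^sup>2 = quartic v"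
    unfolding qfactor_def quartic_def by Groebner_Basis.algebra
  ultimately show False using quartic_unit[OF v] by simp
qed

text \<open>For units this means being a non-square modulo \<open>p\<close>, since -1 is one; in
  this form the property has an explicit witness that can be carried along the orbit.\<close>

definition minus_square :: "rat \<Rightarrow> bool" where
  "minus_square x \<longleftrightarrow> (\<exists>t. in_Zloc p t \<and> in_pZloc p (x + t\<^sup>2))"

text \<open>Modulo \<open>p\<close>, \<open>9 + 6 * w = 3 * (1 + w)^2\<close> because
  \<open>w^2 = 2\<close>, and \<open>3 = - z^2\<close>.\<close>

lemma minus_square_qfactor_0: "minus_square (qfactor 0)"
proof -
  have "qfactor 0 + (z * (1 + w))\<^sup>2 = (z\<^sup>2 + 3) * (1 + w)\<^sup>2 - (w\<^sup>2 - 2) * 3"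
    unfolding qfactor_def by (simp add: power2_eq_square algebra_simps)
  moreover have "in_pZloc p ((z\<^sup>2 + 3) * (1 + w)\<^sup>2 - (w\<^sup>2 - 2) * 3)"
    by (rule in_pZloc_diff[OF prime in_pZloc_mult_right[OF prime z(2)] in_pZloc_mult_right[OF prime w(2)]])
      (intro loc)+
  ultimately show ?thesis unfolding minus_square_def
    by (intro exI[of _ "z * (1 + w)"]) (auto intro!: loc)
qed

text \<open>If the new \<open>c\<close> were 8 modulo \<open>p\<close>, the quadratic satisfied by
  \<open>v\<close> would become linear and \<open>qfactor v\<close> would be a square as well as
  minus a square. The resulting sum of two squares forces \<open>qfactor v\<close> to vanish modulo
  \<open>p\<close>, against \<open>qfactor_unit\<close>.\<close>

lemma next_c_unit:
  assumes "in_Zloc p c" "in_Zloc p v" "on_curve c v" "minus_square (qfactor v)"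
  shows "\<not> in_pZloc p (next_c c v - 8)"
proof
  let ?c = "next_c c v"
  \<comment> \<open>The quadratic relation reads \<open>24 * v = 55 + ?e\<close>. At
    \<open>v = 55 / 24\<close> and \<open>w^2 = 2\<close> one has
    \<open>24^2 * qfactor v = (89 + 12 * w)^2\<close>.\<close>
  let ?e = "(?c - 8) * (?c + 8 + 2 * v\<^sup>2)"
  assume "in_pZloc p (?c - 8)"
  have c: "in_Zloc p ?c" unfolding next_c_def using assms by (intro loc)
  have "(16 - 2 * ?c) * v\<^sup>2 + 24 * v + 9 - ?c\<^sup>2 = 0"
    using assms(3) on_curve_next_c on_curve_quadratic by blast
  then have "24\<^sup>2 * qfactor v - (89 + 12 * w)\<^sup>2 = ?e * (110 + ?e - 24 * w) - (w\<^sup>2 - 2) * 144"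
    unfolding qfactor_def by Groebner_Basis.algebra
  moreover have "in_pZloc p (?e * (110 + ?e - 24 * w) - (w\<^sup>2 - 2) * 144)"
    by (rule in_pZloc_diff[OF prime in_pZloc_mult_right[OF prime
          in_pZloc_mult_right[OF prime \<open>in_pZloc p (?c - 8)\<close>]] in_pZloc_mult_right[OF prime w(2)]])
      (use c assms in \<open>auto intro!: loc\<close>)+
  ultimately have 1: "in_pZloc p (24\<^sup>2 * qfactor v - (89 + 12 * w)\<^sup>2)" by simp
  obtain t where t: "in_Zloc p t" "in_pZloc p (qfactor v + t\<^sup>2)"
    using assms(4) unfolding minus_square_def by blast
  have "in_pZloc p ((qfactor v + t\<^sup>2) * 24\<^sup>2 - (24\<^sup>2 * qfactor v - (89 + 12 * w)\<^sup>2))"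
    by (rule in_pZloc_diff[OF prime in_pZloc_mult_right[OF prime t(2)] 1]) (intro loc)
  moreover have "(qfactor v + t\<^sup>2) * 24\<^sup>2 - (24\<^sup>2 * qfactor v - (89 + 12 * w)\<^sup>2) = (24 * t)\<^sup>2 + (89 + 12 * w)\<^sup>2"
    by Groebner_Basis.algebra
  ultimately have "in_pZloc p ((24 * t)\<^sup>2 + (89 + 12 * w)\<^sup>2)" by metis
  then have "in_pZloc p (24 * t)"
    by (rule in_pZloc_sum_squares[OF prime mod4, rotated 2]) (use t(1) in \<open>auto intro!: loc\<close>)
  then have "in_pZloc p t" using unit_24 t prime loc by (simp add: in_pZloc_mult_iff)
  then have "in_pZloc p (qfactor v + t\<^sup>2 - t * t)"
    using t prime by (intro in_pZloc_diff in_pZloc_mult_right)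
  then show False using qfactor_unit[OF assms(2)] by (simp add: power2_eq_square)
qed

lemma next_in_Zloc:
  assumes "in_Zloc p c" "in_Zloc p v" "on_curve c v" "minus_square (qfactor v)"
  shows "in_Zloc p (next_c c v)" "in_Zloc p (next_v c v)"
proof -
  show c: "in_Zloc p (next_c c v)" unfolding next_c_def using assms by (intro loc)
  then show "in_Zloc p (next_v c v)"
    unfolding next_v_def using assms next_c_unit by (intro loc in_Zloc_divide prime)
qed

lemma next_K_unit:
  assumes "in_Zloc p c" "in_Zloc p v" "on_curve c v" "minus_square (qfactor v)"
  shows "\<not> in_pZloc p (16 - 2 * next_c c v)"
proof -
  have "16 - 2 * next_c c v = - (2 * (next_c c v - 8))" by simp
  moreover have "\<not> in_pZloc p (2 * (next_c c v - 8))"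
    using next_c_unit[OF assms] next_in_Zloc[OF assms] unit_2 prime
    by (subst in_pZloc_mult_iff) (auto intro!: loc)
  ultimately show ?thesis using in_pZloc_minus[OF prime] by fastforce
qed

text \<open>\<open>qfactor v * qfactor v'\<close> is, up to the factor \<open>K\<^sup>2\<close>, the square of the resultant of
  \<open>qfactor\<close> and \<open>X\<^sup>2 + c'\<close>, because \<open>K (X - v) (X - v') = D - (X\<^sup>2 + c')\<^sup>2\<close>.\<close>

lemma minus_square_next:
  assumes "in_Zloc p c" "in_Zloc p v" "on_curve c v" "minus_square (qfactor v)"
  shows "minus_square (qfactor (next_v c v))"
proof -
  define c' v' where "c' = next_c c v" "v' = next_v c v"
  define K where "K = 16 - 2 * c'"
  have loc': "in_Zloc p c'" "in_Zloc p v'" "in_Zloc p K"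
    using next_in_Zloc[OF assms] unfolding c'_v'_def K_def by (auto intro!: loc)
  have K: "\<not> in_pZloc p K" using next_K_unit[OF assms] unfolding c'_v'_def K_def .
  have "next_c c v \<noteq> 8" using next_c_unit[OF assms] in_pZloc_0[OF prime] by auto
  then have sum: "K * (v + v') = -24" and prod: "K * (v * v') = 9 - c'\<^sup>2"
    using next_sum next_prod assms(3) unfolding c'_v'_def K_def by blast+
  define h where "h = 9 + 6 * w"
  define r where "r = (h - c')\<^sup>2 + w\<^sup>2 * c'"
  define Q where "Q = -8424 - 7776 * w - 1296 * w\<^sup>2 + 972 * c' + 648 * c' * w - 72 * c' * w\<^sup>2
    - 54 * c'\<^sup>2 + 24 * c'\<^sup>2 * w - c'\<^sup>2 * w\<^sup>2"
  have "K\<^sup>2 * (qfactor v * qfactor v') = (K * (v * v'))\<^sup>2 - w * (K * (v * v')) * (K * (v + v'))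
      + h * ((K * (v + v'))\<^sup>2 - 2 * K * (K * (v * v')))
      + w\<^sup>2 * K * (K * (v * v')) - w * h * K * (K * (v + v')) + h\<^sup>2 * K\<^sup>2"
    unfolding qfactor_def h_def by Groebner_Basis.algebra
  also have "\<dots> = r\<^sup>2 + (w\<^sup>2 - 2) * Q"
    unfolding sum prod unfolding r_def Q_def h_def K_def by (simp add: power2_eq_square algebra_simps)
  finally have 1: "K\<^sup>2 * (qfactor v * qfactor v') = r\<^sup>2 + (w\<^sup>2 - 2) * Q" .
  obtain t where t: "in_Zloc p t" "in_pZloc p (qfactor v + t\<^sup>2)"
    using assms(4) unfolding minus_square_def by blast
  have tunit: "\<not> in_pZloc p t"
  proof
    assume "in_pZloc p t"
    then have "in_pZloc p (qfactor v + t\<^sup>2 - t * t)"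
      using t prime by (intro in_pZloc_diff in_pZloc_mult_right)
    then show False using qfactor_unit[OF assms(2)] by (simp add: power2_eq_square)
  qed
  have [simp]: "t \<noteq> 0" "K \<noteq> 0" using tunit K in_pZloc_0[OF prime] by auto
  have tK: "in_Zloc p (t * K)" "\<not> in_pZloc p (t * K)"
    using t loc' tunit K prime by (auto intro!: loc simp: in_pZloc_mult_iff)
  have hv: "in_Zloc p (qfactor v)" "in_Zloc p (qfactor v')" using assms loc' qfactor_in_Zloc by auto
  have r: "in_Zloc p r" "in_Zloc p Q" unfolding r_def Q_def h_def using loc' by (auto intro!: loc)
  \<comment> \<open>From \<open>qfactor v = - t^2\<close> and
    \<open>K^2 * (qfactor v * qfactor v') = r^2\<close> modulo \<open>p\<close>, this is the witness
    for \<open>v'\<close>.\<close>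
  let ?t = "r / (t * K)"
  have t'loc: "in_Zloc p ?t" using r tK prime by (intro in_Zloc_divide)
  have eq: "qfactor v' + ?t\<^sup>2 = inverse ((t * K)\<^sup>2) * ((qfactor v + t\<^sup>2) * (K\<^sup>2 * qfactor v') - (w\<^sup>2 - 2) * Q)"
    using 1 by (simp add: field_simps)
  have "in_pZloc p ((qfactor v + t\<^sup>2) * (K\<^sup>2 * qfactor v') - (w\<^sup>2 - 2) * Q)"
    by (rule in_pZloc_diff[OF prime in_pZloc_mult_right[OF prime t(2)] in_pZloc_mult_right[OF prime w(2)]])
      (use loc' hv r in \<open>auto intro!: loc\<close>)+
  moreover have "in_Zloc p (inverse ((t * K)\<^sup>2))"
    using prime tK t(1) loc'(3) by (intro in_Zloc_inverse loc) (auto simp: in_pZloc_power_iff)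
  ultimately have "in_pZloc p (qfactor v' + ?t\<^sup>2)" unfolding eq by (intro in_pZloc_mult_left[OF prime])
  then show ?thesis unfolding minus_square_def c'_v'_def using t'loc c'_v'_def by metis
qed

lemma orbit_good:
  assumes "orbit (-3, 0) n = (c, v)"
  shows "in_Zloc p c \<and> in_Zloc p v \<and> on_curve c v \<and> minus_square (qfactor v)"
  using assms
proof (induction n arbitrary: c v)
  case 0
  then show ?case using minus_square_qfactor_0 in_Zloc_minus[OF prime, of 3] loc(6-8)
    by (auto simp: on_curve_def quartic_def)
next
  case (Suc n)
  obtain c0 v0 where o: "orbit (-3, 0) n = (c0, v0)" by fastforce
  have IH: "in_Zloc p c0" "in_Zloc p v0" "on_curve c0 v0" "minus_square (qfactor v0)"
    using Suc.IH[OF o] by auto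
  have cv: "c = next_c c0 v0" "v = next_v c0 v0" using Suc.prems o by auto
  have "next_c c0 v0 \<noteq> 8" using next_c_unit[OF IH] in_pZloc_0[OF prime] by auto
  then show ?case unfolding cv
    using next_in_Zloc[OF IH] on_curve_next[OF IH(3)] minus_square_next[OF IH] by blast
qed

end

section \<open>The orbit at the prime 2\<close>

text \<open>The congruence \<open>c = 8\<close> modulo 64 in the localisation at 2, a 2-adic
  neighbourhood of the value of \<open>c\<close> at infinity.\<close>

definition odd_state :: "rat \<Rightarrow> bool" where
  "odd_state c \<longleftrightarrow> in_Zloc 2 ((c - 8) / 64)"

lemma two_is_prime_int: "prime (2 :: int)"
  by simp

lemmas loc2 = in_Zloc_intros[OF two_is_prime_int] in_Zloc_numeral[OF two_is_prime_int]

lemma in_pZloc_2_even: "in_Zloc 2 x \<Longrightarrow> in_pZloc 2 (2 * x)"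
  by (simp add: in_pZloc_def)

lemma unit_1_plus_even: "in_Zloc 2 x \<Longrightarrow> \<not> in_pZloc 2 (1 + 2 * x)"
  using in_pZloc_diff[OF two_is_prime_int _ in_pZloc_2_even[of x], of "1 + 2 * x"]
    not_in_pZloc_1[OF two_is_prime_int] by auto

text \<open>The Newton polygon of \<open>(16 - 2c) X\<^sup>2 + 24 X + 9 - c\<^sup>2\<close> at 2.\<close>

lemma odd_state_root:
  assumes "odd_state c" "on_curve c v"
  obtains d w where "in_Zloc 2 d" "in_Zloc 2 w" "w \<noteq> 0" "c = 8 + 64 * d" "v = 1 / (8 * w)"
proof -
  define d where "d = (c - 8) / 64"
  have d: "in_Zloc 2 d" "c = 8 + 64 * d" using assms(1) by (auto simp: odd_state_def d_def field_simps)
  have eq: "(16 - 2 * c) * v\<^sup>2 + 24 * v + 9 - c\<^sup>2 = 0" using assms(2) on_curve_quadratic by blast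
  have unit: "\<not> in_pZloc 2 (c\<^sup>2 - 9)"
  proof -
    have "c\<^sup>2 - 9 = 1 + 2 * (27 + 512 * d + 2048 * d\<^sup>2)" unfolding d(2) by Groebner_Basis.algebra
    then show ?thesis using unit_1_plus_even[of "27 + 512 * d + 2048 * d\<^sup>2"] d(1) by (auto intro!: loc2)
  qed
  have v0: "v \<noteq> 0"
  proof
    assume "v = 0"
    then have "c\<^sup>2 - 9 = 0" using eq by simp
    then show False using unit in_pZloc_0[OF two_is_prime_int] by simp
  qed
  define w where "w = 1 / (8 * v)"
  have vw: "v * (8 * w) = 1" and w0: "w \<noteq> 0" using v0 by (auto simp: w_def)
  have v: "v = 1 / (8 * w)" using v0 by (simp add: w_def)
  \<comment> \<open>The reciprocal equation, scaled by \<open>v = 1 / (8 * w)\<close>. Its leading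
    coefficient \<open>c^2 - 9\<close> is a 2-adic unit, so \<open>w\<close> is integral at
    2.\<close>
  have "w\<^sup>2 * (c\<^sup>2 - 9) = 3 * w - 2 * d"
  proof -
    have "64 * w\<^sup>2 * ((16 - 2 * c) * v\<^sup>2 + 24 * v + 9 - c\<^sup>2) =
      (16 - 2 * c) * (v * (8 * w))\<^sup>2 + 192 * w * (v * (8 * w)) - 64 * w\<^sup>2 * (c\<^sup>2 - 9)"
      by Groebner_Basis.algebra
    then have "64 * (w\<^sup>2 * (c\<^sup>2 - 9)) = (16 - 2 * c) + 192 * w" unfolding vw eq by simp
    then show ?thesis using d(2) by simp
  qed
  have "in_Zloc 2 w"
  proof (rule ccontr)
    assume "\<not> in_Zloc 2 w"
    then have y: "in_pZloc 2 (inverse w)" by (rule in_pZloc_inverse[OF two_is_prime_int])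
    have yl: "in_Zloc 2 (inverse w)" using y by (rule in_pZloc_imp_in_Zloc[OF two_is_prime_int])
    have "c\<^sup>2 - 9 = inverse w * inverse w * (w\<^sup>2 * (c\<^sup>2 - 9))" using w0 by (simp add: power2_eq_square field_simps)
    also have "\<dots> = inverse w * (3 - 2 * d * inverse w)"
      unfolding \<open>w\<^sup>2 * (c\<^sup>2 - 9) = 3 * w - 2 * d\<close> using w0 by (simp add: field_simps)
    finally show False using unit in_pZloc_mult_right[OF two_is_prime_int y, of "3 - 2 * d * inverse w"] d(1) yl
      by (auto intro!: loc2)
  qed
  then show ?thesis using that d v w0 by blast
qed

text \<open>With \<open>v = 1 / (8 * w)\<close>, the number \<open>32 * w^2 * c'\<close> is a 2-adic
  unit, so \<open>c'\<close> cannot be integral. Two steps change \<open>c\<close> by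
  \<open>4 * s * v - 2 * s^2\<close> with \<open>s = v + v' = 12 / (c' - 8)\<close>; since
  \<open>s\<close> is a multiple of \<open>384 * w^2\<close>, this change is divisible by
  64.\<close>

lemma odd_state_step:
  assumes "odd_state c" "on_curve c v"
  defines "c' \<equiv> next_c c v"
  defines "v' \<equiv> next_v c v"
  shows "\<not> in_Zloc 2 c'" "odd_state (next_c c' v')"
proof -
  obtain d w where dw: "in_Zloc 2 d" "in_Zloc 2 w" "w \<noteq> 0" "c = 8 + 64 * d" "v = 1 / (8 * w)"
    using odd_state_root[OF assms(1,2)] by blast
  have vw: "8 * w * v = 1" using dw by simp
  have c'w: "32 * w\<^sup>2 * c' = - (1 + 2 * (128 * w\<^sup>2 + 1024 * d * w\<^sup>2))"
    using vw unfolding c'_def next_c_def dw(4) by Groebner_Basis.algebra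
  show nc': "\<not> in_Zloc 2 c'"
  proof
    assume "in_Zloc 2 c'"
    then have "in_pZloc 2 (- (2 * (16 * w\<^sup>2 * c')))"
      using dw by (intro in_pZloc_minus in_pZloc_2_even loc2 two_is_prime_int)
    moreover have "- (2 * (16 * w\<^sup>2 * c')) = 1 + 2 * (128 * w\<^sup>2 + 1024 * d * w\<^sup>2)"
      using c'w by simp
    ultimately show False using unit_1_plus_even[of "128 * w\<^sup>2 + 1024 * d * w\<^sup>2"] dw by (auto intro!: loc2)
  qed
  \<comment> \<open>The unit \<open>-32 * w^2 * (c' - 8)\<close>; inverting it makes
    \<open>12 / (c' - 8)\<close> explicit.\<close>
  define e where "e = 1 + 2 * (256 * w\<^sup>2 + 1024 * d * w\<^sup>2)"
  have e: "\<not> in_pZloc 2 e" "in_Zloc 2 e"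
    using unit_1_plus_even[of "256 * w\<^sup>2 + 1024 * d * w\<^sup>2"] dw unfolding e_def by (auto intro!: loc2)
  then have e0: "e \<noteq> 0" using in_pZloc_0[OF two_is_prime_int] by auto
  have c'8: "32 * w\<^sup>2 * (c' - 8) = - e" using c'w unfolding e_def by (simp add: algebra_simps)
  define g where "g = inverse e"
  have g: "in_Zloc 2 g" unfolding g_def by (rule in_Zloc_inverse[OF two_is_prime_int e(2,1)])
  have ge: "g * e = 1" unfolding g_def using e0 by simp
  have n8: "c' - 8 \<noteq> 0" using c'8 e0 by auto
  have s: "v + v' = - (384 * w\<^sup>2 * g)"
  proof -
    have "v + v' = 12 / (c' - 8)" unfolding v'_def next_v_def c'_def by simp
    also have "\<dots> = - (384 * w\<^sup>2 * g)"
    proof -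
      have "- (384 * w\<^sup>2 * g) * (c' - 8) = 12 * (g * e)" using c'8 by Groebner_Basis.algebra
      then show ?thesis using ge n8 by (simp add: divide_eq_eq)
    qed
    finally show ?thesis .
  qed
  have "next_c c' v' = c + 4 * (v + v') * v - 2 * (v + v')\<^sup>2"
    unfolding next_c_def[of c'] unfolding c'_def next_c_def by Groebner_Basis.algebra
  also have "\<dots> = 8 + 64 * (d - 3 * w * g - 4608 * w^4 * g\<^sup>2)"
    unfolding s dw(4) using vw by Groebner_Basis.algebra
  finally have fin: "(next_c c' v' - 8) / 64 = d - 3 * w * g - 4608 * w^4 * g\<^sup>2" by simp
  then show "odd_state (next_c c' v')" unfolding odd_state_def fin using dw g by (auto intro!: loc2)
qed

text \<open>\<open>X^2 + 8\<close> is the polynomial part of \<open>sqrt D\<close>, and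
  \<open>D - (X^2 + 8)^2 = 24 * X - 55\<close>: one root of the quadratic lies at infinity and the
  other is \<open>55 / 24\<close>.\<close>

abbreviation "pell_c n \<equiv> fst (orbit (8, 55 / 24) n)"
abbreviation "pell_v n \<equiv> snd (orbit (8, 55 / 24) n)"

text \<open>\<open>odd_state_step\<close> advances two steps at once; the clause on
  \<open>next_c\<close> at odd \<open>n\<close> stores its second half for the next induction
  step.\<close>

lemma orbit_parity:
  assumes "\<And>k. 0 < k \<Longrightarrow> k \<le> n \<Longrightarrow> pell_c k \<noteq> 8"
  shows "on_curve (pell_c n) (pell_v n) \<and> (if even n then odd_state (pell_c n) else
    \<not> in_Zloc 2 (pell_c n) \<and> odd_state (next_c (pell_c n) (pell_v n)))"
  using assms
proof (induction n)
  case 0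
  then show ?case using in_Zloc_numeral(1)[OF two_is_prime_int]
    by (auto simp: on_curve_def quartic_def odd_state_def field_simps power2_eq_square power4_eq_xxxx)
next
  case (Suc n)
  have IH: "on_curve (pell_c n) (pell_v n)" "if even n then odd_state (pell_c n) else
    \<not> in_Zloc 2 (pell_c n) \<and> odd_state (next_c (pell_c n) (pell_v n))"
    using Suc by auto
  have "next_c (pell_c n) (pell_v n) \<noteq> 8" using Suc.prems[of "Suc n"] by simp
  then have "on_curve (pell_c (Suc n)) (pell_v (Suc n))" using on_curve_next[OF IH(1)] by simp
  then show ?case using IH odd_state_step[of "pell_c n" "pell_v n"] by (auto split: if_splits)
qed

text \<open>At a first return \<open>m\<close> the orbit is a palindrome, and \<open>m\<close> is
  even since \<open>c\<close> is non-integral at odd indices. At the centre the two neighbouring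
  roots coincide, which leaves three values of \<open>c\<close>, all integral but not 8 modulo
  64.\<close>

lemma orbit_ne_8:
  assumes "n > 0" shows "pell_c n \<noteq> 8"
proof
  assume "pell_c n = 8"
  define m where "m = (LEAST k. k > 0 \<and> pell_c k = 8)"
  have m: "m > 0" "pell_c m = 8" using LeastI[of "\<lambda>k. k > 0 \<and> pell_c k = 8" n] assms \<open>pell_c n = 8\<close>
    unfolding m_def by auto
  have least: "pell_c k \<noteq> 8" if "0 < k" "k < m" for k
    using not_less_Least[of k "\<lambda>k. k > 0 \<and> pell_c k = 8"] that unfolding m_def by auto
  have par: "on_curve (pell_c k) (pell_v k)" "if even k then odd_state (pell_c k) else
    \<not> in_Zloc 2 (pell_c k) \<and> odd_state (next_c (pell_c k) (pell_v k))" if "k < m" for k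
    using orbit_parity[of k] least that by auto
  obtain l where l: "m = Suc l" using m(1) gr0_implies_Suc by blast
  have "even m"
  proof (rule ccontr)
    assume "odd m"
    then have "\<not> in_Zloc 2 (pell_c m)" using par[of l] odd_state_step(1)[of "pell_c l" "pell_v l"] unfolding l by auto
    then show False using m(2) in_Zloc_numeral(3)[OF two_is_prime_int] by simp
  qed
  \<comment> \<open>The recursion is reversible: \<open>c\<close> at index \<open>j + 1\<close>
    belongs to the root pair \<open>v\<close> at \<open>j\<close> and \<open>j + 1\<close>, so
    running backwards from the return obeys the same rules. It starts equally because
    \<open>c = 8\<close> determines \<open>v = 55 / 24\<close>.\<close>
  have sym: "pell_v (m - 1 - k) = pell_v k \<and> pell_c (m - k) = pell_c k" if "k < m" for k
    using that
  proof (induction k)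
    case 0
    have "on_curve (next_c (pell_c l) (pell_v l)) (pell_v l)" using par[of l] on_curve_next_c unfolding l by blast
    then have "on_curve 8 (pell_v l)" using m(2) unfolding l by simp
    then have "pell_v l = 55 / 24" unfolding on_curve_quadratic by simp
    then show ?case using m(2) l by simp
  next
    case (Suc k)
    then have IH: "pell_v (m - 1 - k) = pell_v k" "pell_c (m - k) = pell_c k" by auto
    define j where "j = m - 1 - Suc k"
    have j: "m - 1 - k = Suc j" "m - k = Suc (Suc j)" "m - Suc k = Suc j" using Suc.prems j_def by auto
    have "pell_c (Suc j) = - pell_c (Suc (Suc j)) - 2 * (pell_v (Suc j))\<^sup>2"
      by (simp add: next_c_def[of "pell_c (Suc j)"] next_c_def[of "next_c _ _"])
    also have "\<dots> = pell_c (Suc k)" using IH unfolding j by (simp add: next_c_def[of "pell_c k"])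
    finally have c: "pell_c (Suc j) = pell_c (Suc k)" .
    have "pell_v j = 12 / (pell_c (Suc j) - 8) - pell_v (Suc j)" by (simp add: next_v_def)
    also have "\<dots> = pell_v (Suc k)" using IH(1) c unfolding j by (simp add: next_v_def)
    finally show ?case using c unfolding j_def[symmetric] j by simp
  qed
  obtain h where h: "m = 2 * h" "h > 0" using \<open>even m\<close> m(1) by auto
  obtain i where i: "h = Suc i" using h(2) gr0_implies_Suc by blast
  let ?c = "pell_c h" and ?v = "pell_v h"
  have hm: "h < m" "m - 1 - h = i" using h i by auto
  have c8: "?c \<noteq> 8" using least[of h] h hm by simp
  \<comment> \<open>A double root of \<open>D - (X^2 + ?c)^2\<close>. Eliminating \<open>?v\<close>
    gives a cubic in \<open>?c\<close> with roots 0, 9 and -1, corresponding to the points of order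
    two.\<close>
  have "pell_v i = ?v" using sym[of h] hm by simp
  moreover have "?v = 12 / (?c - 8) - pell_v i" unfolding i by (simp add: next_v_def)
  ultimately have "2 * ?v = 12 / (?c - 8)" by simp
  then have v: "(?c - 8) * ?v = 6" using c8 by (simp add: field_simps)
  have "(16 - 2 * ?c) * ?v\<^sup>2 + 24 * ?v + 9 - ?c\<^sup>2 = 0"
    using par(1)[OF hm(1)] on_curve_quadratic by blast
  then have "?c * (?c - 9) * (?c + 1) = 0" using v by Groebner_Basis.algebra
  then have "?c = 0 \<or> ?c = 9 \<or> ?c = -1" by auto
  moreover have "in_Zloc 2 0" "in_Zloc 2 9" "in_Zloc 2 (-1)" by (auto intro!: loc2)
  moreover have "\<not> odd_state 0" "\<not> odd_state 9" "\<not> odd_state (-1)"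
  proof -
    have q: "\<not> in_Zloc 2 (of_int a / of_int (2 * b))" if "odd a" "b \<noteq> 0" for a b :: int
    proof
      assume "in_Zloc 2 (of_int a / of_int (2 * b))"
      then have "in_pZloc 2 (2 * (of_int b * (of_int a / of_int (2 * b))))"
        by (intro in_pZloc_2_even in_Zloc_mult two_is_prime_int in_Zloc_of_int)
      moreover have "2 * (of_int b * (of_int a / of_int (2 * b))) = (of_int a :: rat)" using that by simp
      ultimately show False using that in_pZloc_of_int[OF two_is_prime_int] by metis
    qed
    \<comment> \<open>The values of \<open>(c - 8) / 64\<close> are \<open>-1/8\<close>,
      \<open>1/64\<close> and \<open>-9/64\<close>.\<close>
    show "\<not> odd_state 0" "\<not> odd_state 9" "\<not> odd_state (-1)"
      using q[of "-1" 4] q[of 1 32] q[of "-9" 32] by (auto simp: odd_state_def)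
  qed
  ultimately show False using par(2)[OF hm(1)] by (metis (full_types))
qed

section \<open>Descent for the Pell equation\<close>

definition qpoly :: "rat poly" where
  "qpoly = [:9, 24, 16, 0, 1:]"

definition rpoly :: "rat \<Rightarrow> rat poly" where
  "rpoly c = [:c, 0, 1:]"

definition lin :: "rat \<Rightarrow> rat poly" where
  "lin v = [:- v, 1:]"

lemma qpoly_lead [simp]: "qpoly \<noteq> 0" "degree qpoly = 4" "coeff qpoly 4 = 1"
  by (simp_all add: qpoly_def numeral_eq_Suc)

lemma rpoly_lead [simp]: "rpoly c \<noteq> 0" "degree (rpoly c) = 2" "coeff (rpoly c) 2 = 1"
  by (simp_all add: rpoly_def numeral_eq_Suc)

lemma lin_lead [simp]: "lin v \<noteq> 0" "degree (lin v) = 1"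
  by (simp_all add: lin_def)

lemma qpoly_minus_rpoly:
  assumes "on_curve c v" "next_c c v \<noteq> 8"
  defines "c' \<equiv> next_c c v" and "v' \<equiv> next_v c v"
  shows "qpoly - (rpoly c')\<^sup>2 = smult (16 - 2 * c') (lin v * lin v')"
  using next_sum[OF assms(1,2)] next_prod[OF assms(1,2)]
  unfolding rpoly_def qpoly_def lin_def c'_def[symmetric] v'_def[symmetric]
  by (simp add: power2_eq_square algebra_simps)

lemma norm_form_lead:
  fixes A B :: "rat poly"
  assumes "degree (A\<^sup>2 - qpoly * B\<^sup>2) \<le> 1" "B \<noteq> 0"
  shows "degree A = degree B + 2" "lead_coeff A = lead_coeff B \<or> lead_coeff A = - lead_coeff B"
proof -
  let ?E = "A\<^sup>2 - qpoly * B\<^sup>2"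
  have dB: "degree (qpoly * B\<^sup>2) = 4 + 2 * degree B"
    using assms(2) by (simp add: degree_mult_eq degree_power_eq)
  have A: "A\<^sup>2 = ?E + qpoly * B\<^sup>2" by simp
  have dA: "degree (A\<^sup>2) = 4 + 2 * degree B"
    by (subst A, subst degree_add_eq_right) (use assms(1) dB in auto)
  then have A0: "A \<noteq> 0" by auto
  then show "degree A = degree B + 2" using dA by (simp add: degree_power_eq)
  have "coeff ?E (4 + 2 * degree B) = 0" using assms(1) by (intro coeff_eq_0) simp
  then have "coeff (A\<^sup>2) (4 + 2 * degree B) = coeff (qpoly * B\<^sup>2) (4 + 2 * degree B)"
    by simp
  then have "lead_coeff (A\<^sup>2) = lead_coeff (qpoly * B\<^sup>2)" unfolding dA dB .
  also have "\<dots> = (lead_coeff B)\<^sup>2" by (simp add: lead_coeff_mult lead_coeff_power)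
  finally have "(lead_coeff A)\<^sup>2 = (lead_coeff B)\<^sup>2" by (simp add: lead_coeff_power)
  then show "lead_coeff A = lead_coeff B \<or> lead_coeff A = - lead_coeff B"
    by (simp add: power2_eq_iff)
qed

lemma square_ne_linear:
  fixes A :: "rat poly"
  assumes "e \<noteq> 0"
  shows "A\<^sup>2 \<noteq> smult e (lin v)"
proof
  assume eq: "A\<^sup>2 = smult e (lin v)"
  have "degree (A\<^sup>2) = 1" unfolding eq using assms by simp
  then show False by (cases "A = 0") (auto simp: degree_power_eq)
qed

lemma degree_rpoly_mult:
  fixes B :: "rat poly"
  assumes "B \<noteq> 0"
  shows "degree (B * rpoly c) = degree B + 2" "coeff (B * rpoly c) (degree B + 2) = lead_coeff B"
  using assms coeff_mult_degree_sum[of B "rpoly c"] by (simp_all add: degree_mult_eq)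

text \<open>The sign of \<open>lead_coeff A\<close> decides which of \<open>A \<plusminus> B \<surd>D\<close> is small at infinity.\<close>

lemma lead_coeff_eqI:
  fixes A B :: "rat poly"
  assumes N: "degree (A\<^sup>2 - qpoly * B\<^sup>2) \<le> 1" "B \<noteq> 0"
    and d: "degree (A + B * rpoly c) \<ge> degree B + 2"
  shows "lead_coeff A = lead_coeff B"
proof (rule ccontr)
  assume "lead_coeff A \<noteq> lead_coeff B"
  then have l: "lead_coeff A = - lead_coeff B" and dA: "degree A = degree B + 2"
    using norm_form_lead[OF N] by auto
  have 0: "coeff (A + B * rpoly c) (degree B + 2) = 0"
    using l dA degree_rpoly_mult(2)[OF N(2), of c] by simp
  moreover have "degree (A + B * rpoly c) \<le> degree B + 2"
    using dA degree_rpoly_mult(1)[OF N(2), of c] by (intro degree_add_le) auto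
  then have "degree (A + B * rpoly c) = degree B + 2" using d by simp
  with 0 have "lead_coeff (A + B * rpoly c) = 0" by simp
  then have "A + B * rpoly c = 0" unfolding leading_coeff_0_iff .
  then show False using d by simp
qed

text \<open>Equal leading coefficients prevent cancellation in \<open>A + B * rpoly c\<close>, so
  its degree is at least \<open>degree B + 2\<close>. Its product with
  \<open>A - B * rpoly c\<close> is the norm plus \<open>B^2 * (qpoly - (rpoly c)^2)\<close>, of
  small degree.\<close>

lemma norm_form_diff_degree:
  fixes A B :: "rat poly"
  assumes N: "degree (A\<^sup>2 - qpoly * B\<^sup>2) \<le> 1" "B \<noteq> 0" and l: "lead_coeff A = lead_coeff B"
    and nz: "A - B * rpoly c \<noteq> 0" and d: "degree (qpoly - (rpoly c)\<^sup>2) \<le> m" "m \<ge> 1"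
  shows "degree (A - B * rpoly c) + 2 \<le> degree B + m"
proof -
  have dA: "degree A = degree B + 2" using norm_form_lead[OF N] by simp
  have c: "coeff (A + B * rpoly c) (degree B + 2) = 2 * lead_coeff B"
    using l dA degree_rpoly_mult(2)[OF N(2), of c] by simp
  then have c0: "coeff (A + B * rpoly c) (degree B + 2) \<noteq> 0" using N(2) by simp
  then have nz': "A + B * rpoly c \<noteq> 0" by (metis coeff_0)
  have dge: "degree (A + B * rpoly c) \<ge> degree B + 2" using c0 by (rule le_degree)
  have "(A - B * rpoly c) * (A + B * rpoly c) = (A\<^sup>2 - qpoly * B\<^sup>2) + B\<^sup>2 * (qpoly - (rpoly c)\<^sup>2)"
    by (simp add: power2_eq_square algebra_simps)
  moreover have "degree \<dots> \<le> 2 * degree B + m"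
  proof (rule degree_add_le)
    show "degree (A\<^sup>2 - qpoly * B\<^sup>2) \<le> 2 * degree B + m" using N d by simp
    show "degree (B\<^sup>2 * (qpoly - (rpoly c)\<^sup>2)) \<le> 2 * degree B + m"
      using degree_mult_le[of "B\<^sup>2" "qpoly - (rpoly c)\<^sup>2"] d N(2) by (simp add: degree_power_eq)
  qed
  moreover have "degree ((A - B * rpoly c) * (A + B * rpoly c)) =
      degree (A - B * rpoly c) + degree (A + B * rpoly c)"
    using nz nz' by (rule degree_mult_eq)
  ultimately show ?thesis using dge by simp
qed

text \<open>Infinite descent on \<open>degree B\<close>. The divisibility hypothesis says that the
  function \<open>A + B * y\<close> vanishes at the orbit point \<open>(v, c + v^2)\<close>.
  Multiplying \<open>A + B * sqrt D\<close> by \<open>X^2 + c' - sqrt D\<close> and dividing by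
  \<open>X - v\<close> gives \<open>A' + B' * sqrt D\<close> of the same shape at the next orbit
  point. Equal leading coefficients make \<open>A - B * sqrt D\<close> small at infinity, whence
  \<open>degree B' < degree B\<close>; and \<open>B' = 0\<close> would make a linear polynomial a
  square.\<close>

lemma no_norm_form:
  fixes A B C :: "rat poly"
  assumes "A\<^sup>2 - qpoly * B\<^sup>2 = smult e (lin (pell_v n))" "e \<noteq> 0"
    and "A + B * rpoly (pell_c n) = C * lin (pell_v n)"
    and "B \<noteq> 0" "lead_coeff A = lead_coeff B"
  shows False
  using assms
proof (induction "degree B" arbitrary: A B C e n rule: less_induct)
  case less
  define c v c' v' where cv: "c = pell_c n" "v = pell_v n" "c' = next_c c v" "v' = next_v c v"
  have on: "on_curve c v" unfolding cv using orbit_parity orbit_ne_8 by auto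
  have c8: "c' \<noteq> 8" using orbit_ne_8[of "Suc n"] unfolding cv by simp
  let ?r = "rpoly c'"
  define K where "K = 16 - 2 * c'"
  have K: "K \<noteq> 0" using c8 by (simp add: K_def)
  have D: "qpoly - ?r\<^sup>2 = smult K (lin v * lin v')"
    using qpoly_minus_rpoly[OF on] c8 unfolding cv K_def by simp
  have N: "A\<^sup>2 - qpoly * B\<^sup>2 = smult e (lin v)" using less.prems(1) cv by simp
  have rr: "rpoly c + ?r = smult 2 ([:v, 1:] * lin v)"
    unfolding rpoly_def cv(3) next_c_def lin_def by (simp add: power2_eq_square)
  \<comment> \<open>The quotient of \<open>B * ?r - A\<close> by \<open>X - v\<close>: write the
    former as \<open>B * (rpoly c + ?r) - (A + B * rpoly c)\<close>, where both terms are
    divisible.\<close>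
  define B' where "B' = smult 2 (B * [:v, 1:]) - C"
  have B': "B' * lin v = B * ?r - A"
  proof -
    have "B' * lin v = B * smult 2 ([:v, 1:] * lin v) - C * lin v"
      unfolding B'_def by (simp add: left_diff_distrib mult.assoc del: mult_pCons_right mult_pCons_left)
    also have "C * lin v = A + B * rpoly c" using less.prems(3) cv by simp
    finally show ?thesis unfolding rr[symmetric] by (simp add: algebra_simps)
  qed
  \<comment> \<open>The quotient of \<open>A * ?r - qpoly * B\<close> by \<open>X - v\<close>,
    written so that the divisibility needed at the next point, whose \<open>c\<close> is
    \<open>c'\<close>, is immediate.\<close>
  define A' where "A' = - smult K (B * lin v') - B' * ?r"
  have A'B': "A' + B' * ?r = - smult K (B * lin v')" unfolding A'_def by simp
  have A': "A' * lin v = A * ?r - qpoly * B"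
  proof -
    have "A' * lin v = - (B * smult K (lin v * lin v')) - (B' * lin v) * ?r"
      unfolding A'_def by (simp add: algebra_simps)
    then show ?thesis unfolding D[symmetric] B' by (simp add: power2_eq_square algebra_simps)
  qed
  have "(lin v)\<^sup>2 * (A'\<^sup>2 - qpoly * B'\<^sup>2) = (A' * lin v)\<^sup>2 - qpoly * (B' * lin v)\<^sup>2"
    by (simp add: power2_eq_square algebra_simps)
  also have "\<dots> = - ((A\<^sup>2 - qpoly * B\<^sup>2) * (qpoly - ?r\<^sup>2))"
    unfolding A' B' by (simp add: power2_eq_square algebra_simps)
  also have "\<dots> = (lin v)\<^sup>2 * smult (- e * K) (lin v')"
    unfolding N D by (simp add: power2_eq_square algebra_simps)
  finally have N': "A'\<^sup>2 - qpoly * B'\<^sup>2 = smult (- e * K) (lin v')"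
    by (subst (asm) mult_cancel_left) simp
  have eK: "- e * K \<noteq> 0" using less.prems(2) K by simp
  have dN': "degree (A'\<^sup>2 - qpoly * B'\<^sup>2) \<le> 1" unfolding N' by simp
  have dN: "degree (A\<^sup>2 - qpoly * B\<^sup>2) \<le> 1" unfolding N by simp
  have B'0: "B' \<noteq> 0"
  proof
    assume "B' = 0"
    then have "A'\<^sup>2 = smult (- e * K) (lin v')" using N' by simp
    then show False using square_ne_linear[OF eK] by blast
  qed
  have d2: "degree (qpoly - ?r\<^sup>2) = 2" unfolding D using K by (simp add: degree_mult_eq)
  have AB': "A - B * ?r = - (B' * lin v)" unfolding B' by simp
  then have nz: "A - B * ?r \<noteq> 0" using B'0 by simp
  have "degree (A - B * ?r) + 2 \<le> degree B + 2"
    by (rule norm_form_diff_degree[OF dN less.prems(4,5) nz]) (simp_all add: d2)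
  moreover have "degree (A - B * ?r) = degree B' + 1" unfolding AB' using B'0 by (simp add: degree_mult_eq)
  ultimately have deg: "degree B' < degree B" by simp
  have "degree (A' + B' * ?r) = degree B + 1"
    unfolding A'B' using K less.prems(4) by (simp add: degree_mult_eq)
  then have l': "lead_coeff A' = lead_coeff B'" using deg by (intro lead_coeff_eqI[OF dN' B'0, of c']) simp
  have "A' + B' * rpoly (pell_c (Suc n)) = - smult K B * lin (pell_v (Suc n))"
    using A'B' unfolding cv by simp
  moreover have "A'\<^sup>2 - qpoly * B'\<^sup>2 = smult (- e * K) (lin (pell_v (Suc n)))"
    using N' unfolding cv by simp
  ultimately show False using less.hyps[OF deg _ eK _ B'0 l'] by blast
qed

text \<open>Multiplying a unit \<open>P + Q * sqrt D\<close> by \<open>X^2 + 8 - sqrt D\<close>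
  produces an element of norm \<open>- k * (24 * X - 55)\<close>, which starts the descent at index
  0.\<close>

lemma not_pellian_qpoly: "\<not> pellian qpoly"
proof
  assume "pellian qpoly"
  then obtain P0 Q k where PQ0: "Q \<noteq> 0" "k \<noteq> 0" "P0\<^sup>2 - qpoly * Q\<^sup>2 = [:k:]"
    unfolding pellian_def by blast
  have "degree (P0\<^sup>2 - qpoly * Q\<^sup>2) \<le> 1" unfolding PQ0(3) by simp
  \<comment> \<open>Changing the sign of \<open>P0\<close> preserves the norm; it selects the
    solution with \<open>P - Q * sqrt D\<close> small at infinity.\<close>
  then have "lead_coeff P0 = lead_coeff Q \<or> lead_coeff (- P0) = lead_coeff Q"
    using norm_form_lead(2) PQ0(1) by fastforce
  then obtain P where PQ: "P\<^sup>2 - qpoly * Q\<^sup>2 = [:k:]" and l: "lead_coeff P = lead_coeff Q"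
    using PQ0(3) power2_minus[of P0] by metis
  let ?r = "rpoly 8"
  have D: "qpoly - ?r\<^sup>2 = smult 24 (lin (55 / 24))"
    by (simp add: qpoly_def rpoly_def lin_def power2_eq_square)
  define A where "A = P * ?r - qpoly * Q"
  define B where "B = Q * ?r - P"
  have "A\<^sup>2 - qpoly * B\<^sup>2 = - ((P\<^sup>2 - qpoly * Q\<^sup>2) * (qpoly - ?r\<^sup>2))"
    unfolding A_def B_def by (simp add: power2_eq_square algebra_simps)
  also have "\<dots> = smult (- 24 * k) (lin (55 / 24))" unfolding PQ D by simp
  finally have N: "A\<^sup>2 - qpoly * B\<^sup>2 = smult (- 24 * k) (lin (55 / 24))" .
  have k: "- 24 * k \<noteq> 0" using PQ0(2) by simp
  have AB: "A + B * ?r = smult (- 24) Q * lin (55 / 24)"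
  proof -
    have "A + B * ?r = - (Q * (qpoly - ?r\<^sup>2))"
      unfolding A_def B_def by (simp add: power2_eq_square algebra_simps)
    then show ?thesis unfolding D by simp
  qed
  have B0: "B \<noteq> 0"
  proof
    assume "B = 0"
    then show False using N square_ne_linear[OF k, of A "55 / 24"] by simp
  qed
  have dN: "degree (A\<^sup>2 - qpoly * B\<^sup>2) \<le> 1" unfolding N by simp
  have dPQ: "degree (P\<^sup>2 - qpoly * Q\<^sup>2) \<le> 1" unfolding PQ by simp
  have PB: "P - Q * ?r = - B" by (simp add: B_def)
  have "degree (P - Q * ?r) + 2 \<le> degree Q + 1"
    by (rule norm_form_diff_degree[OF dPQ PQ0(1) l]) (simp_all add: PB B0 D)
  then have "degree B + 2 \<le> degree Q + 1" unfolding PB by simp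
  moreover have "degree (A + B * ?r) = degree Q + 1"
    unfolding AB using PQ0(1) by (simp add: degree_mult_eq)
  ultimately have "lead_coeff A = lead_coeff B" by (intro lead_coeff_eqI[OF dN B0, of 8]) simp
  then show False
    using no_norm_form[of A B "- 24 * k" 0 "smult (- 24) Q"] N AB B0 k by simp
qed

section \<open>Reduction of Laurent series\<close>

unbundle fps_syntax

lemma fls_frac_nth [simp]: "fls_frac f $$ k = (if k > 0 then f $$ k else 0)"
  by (simp add: fls_frac.rep_eq)

lemma fls_mod_nth [simp]: "fls_mod p f $$ k = f $$ k mod p"
  by (simp add: fls_mod.rep_eq)

lemma red_ser_nth [simp]: "red_ser p f $$ k = red_rat p (f $$ k)"
  by (simp add: red_ser.rep_eq)

lemma fls_frac_add: "fls_frac (f + g) = fls_frac f + fls_frac g" for f g :: "'a::monoid_add fls"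
  by (rule fls_eqI) simp

text \<open>Any lower bounds \<open>a\<close> and \<open>b\<close> serve, so a series and its
  reduction, whose subdegree may be larger, share one summation range.\<close>

lemma fls_times_nth_bounds:
  fixes f g :: "'a::semiring_0 fls"
  assumes "\<And>k. k < a \<Longrightarrow> f $$ k = 0" "\<And>k. k < b \<Longrightarrow> g $$ k = 0"
  shows "(f * g) $$ n = (\<Sum>i=a..n - b. f $$ i * g $$ (n - i))"
proof (cases "f = 0 \<or> g = 0")
  case False
  then have "a \<le> fls_subdegree f" "b \<le> fls_subdegree g" using assms by (auto intro: fls_subdegree_geI)
  then show ?thesis unfolding fls_times_nth(2)
    by (intro sum.mono_neutral_left) auto
qed auto

lemma fls_zero_below:
  fixes f :: "'a::zero fls"
  obtains a where "\<And>k. k < a \<Longrightarrow> f $$ k = 0"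
  using fls_eq0_below_subdegree by blast

lemma fls_mod_mult_left: "fls_mod p (fls_mod p f * g) = fls_mod p (f * g)"
proof (rule fls_eqI)
  fix n
  obtain a b where ab: "\<And>k. k < a \<Longrightarrow> f $$ k = 0" "\<And>k. k < b \<Longrightarrow> g $$ k = 0"
    using fls_zero_below[of f] fls_zero_below[of g] by metis
  have "(fls_mod p f * g) $$ n = (\<Sum>i=a..n - b. (f $$ i mod p) * g $$ (n - i))"
    using ab by (subst fls_times_nth_bounds[where a = a and b = b]) auto
  moreover have "(f * g) $$ n = (\<Sum>i=a..n - b. f $$ i * g $$ (n - i))"
    using ab by (rule fls_times_nth_bounds)
  moreover have "(\<Sum>i=a..n - b. (f $$ i mod p) * g $$ (n - i)) mod p = (\<Sum>i=a..n - b. f $$ i * g $$ (n - i)) mod p"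
    by (subst (1 2) mod_sum_eq[symmetric]) (simp add: mod_mult_left_eq)
  ultimately show "fls_mod p (fls_mod p f * g) $$ n = fls_mod p (f * g) $$ n" by simp
qed

lemma fls_mod_Fp_ser: "Fp_ser p g \<Longrightarrow> fls_mod p g = g"
  by (rule fls_eqI) (simp add: Fp_ser_def)

text \<open>Uniqueness of inverses modulo \<open>p\<close>, which evaluates the \<open>THE\<close>
  in \<open>Fp_inverse\<close>.\<close>

lemma Fp_inverse_eqI:
  assumes g: "Fp_ser p g" "fls_mod p (g * f) = 1"
  shows "Fp_inverse p f = g"
proof -
  have f0: "f \<noteq> 0"
  proof
    assume "f = 0"
    then have "fls_mod p 0 $$ 0 = (1 :: int fls) $$ 0" using g by simp
    then show False by simp
  qed
  have "g' = g" if g': "Fp_ser p g'" "fls_mod p (g' * f) = 1" for g'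
  proof -
    have "g' = fls_mod p (1 * g')" using g'(1) by (simp add: fls_mod_Fp_ser)
    also have "\<dots> = fls_mod p (g * (g' * f))"
      using g(2) fls_mod_mult_left[of p "g * f" g'] by (simp add: ac_simps)
    also have "\<dots> = fls_mod p ((g' * f) * g)" by (simp add: mult.commute)
    also have "\<dots> = fls_mod p (1 * g)" using fls_mod_mult_left[of p "g' * f" g] g'(2) by simp
    finally show ?thesis using g(1) by (simp add: fls_mod_Fp_ser)
  qed
  then have "(THE g. Fp_ser p g \<and> fls_mod p (g * f) = 1) = g" using g by blast
  then show ?thesis unfolding Fp_inverse_def using f0 by simp
qed

text \<open>Replaces the \<open>THE\<close> in \<open>red_rat\<close> by a congruence. The residue
  exists because the denominator is invertible modulo \<open>p\<close>.\<close>

lemma red_rat_iff: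
  assumes p: "prime p" and x: "in_Zloc p x"
  shows "red_rat p x = r \<longleftrightarrow> 0 \<le> r \<and> r < p \<and> in_pZloc p (x - of_int r)"
proof -
  obtain a b where ab: "quotient_of x = (a, b)" by fastforce
  have xab: "x = of_int a / of_int b" and nb: "\<not> p dvd b" and b0: "b \<noteq> 0"
    using quotient_of_div[OF ab] quotient_of_denom_pos[OF ab] x ab by (auto simp: in_Zloc_def)
  have p0: "p > 0" using p prime_gt_0_int by blast
  have key: "(b * s) mod p = a mod p \<longleftrightarrow> in_pZloc p (x - of_int s)" for s
  proof -
    have "x - of_int s = of_int (a - b * s) / of_int b" using b0 xab by (simp add: field_simps)
    then have "in_pZloc p (x - of_int s) \<longleftrightarrow> p dvd a - b * s" using in_pZloc_frac_iff[OF p nb] by metis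
    then show ?thesis by (metis mod_eq_dvd_iff)
  qed
  have uniq: "s = t" if "0 \<le> s" "s < p" "0 \<le> t" "t < p" "in_pZloc p (x - of_int s)" "in_pZloc p (x - of_int t)" for s t
  proof -
    have "in_pZloc p ((x - of_int t) - (x - of_int s))"
      by (rule in_pZloc_diff[OF p that(6,5)])
    then have "p dvd s - t" using in_pZloc_of_int[OF p, of "s - t"] by simp
    then show ?thesis using that by (metis mod_eq_dvd_iff mod_pos_pos_trivial)
  qed
  have "0 \<le> red_rat p x \<and> red_rat p x < p \<and> in_pZloc p (x - of_int (red_rat p x))"
  proof (cases "x = 0")
    case True
    then show ?thesis using p0 in_pZloc_0[OF p] by (simp add: red_rat_def)
  next
    case False
    have "coprime b p" using nb p by (metis coprime_commute prime_imp_coprime)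
    then obtain s where "[b * s = 1] (mod p)" using cong_solve_coprime_int by blast
    then have "[b * (s * a) = a] (mod p)" using cong_mult[of "b * s" 1 p a a] by (simp add: mult.assoc)
    then have "(b * (s * a mod p)) mod p = a mod p" by (simp add: cong_def mod_mult_right_eq)
    then have ex: "0 \<le> s * a mod p" "s * a mod p < p" "in_pZloc p (x - of_int (s * a mod p))"
      using p0 key by auto
    have "red_rat p x = (THE r. 0 \<le> r \<and> r < p \<and> in_pZloc p (x - of_int r))"
      using False ab by (simp add: red_rat_def key)
    also have "\<dots> = s * a mod p" using ex uniq by (intro the_equality) blast+
    finally show ?thesis using ex by simp
  qed
  then show ?thesis using uniq by blast
qed

lemma red_ser_mult:
  assumes p: "prime p" and "ser_in_Zloc p f" "ser_in_Zloc p g"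
  shows "fls_mod p (red_ser p f * red_ser p g) = red_ser p (f * g)"
proof (rule fls_eqI)
  fix n
  have f: "in_Zloc p (f $$ k)" and g: "in_Zloc p (g $$ k)" for k using assms by (auto simp: ser_in_Zloc_def)
  obtain a b where ab: "\<And>k. k < a \<Longrightarrow> f $$ k = 0" "\<And>k. k < b \<Longrightarrow> g $$ k = 0"
    using fls_zero_below[of f] fls_zero_below[of g] by metis
  let ?R = "\<lambda>f k. red_rat p (f $$ k)"
  have r0: "red_rat p 0 = 0" by (simp add: red_rat_def)
  have 1: "(red_ser p f * red_ser p g) $$ n = (\<Sum>i=a..n - b. ?R f i * ?R g (n - i))"
    using ab by (subst fls_times_nth_bounds[where a = a and b = b]) (auto simp: r0)
  have 2: "(f * g) $$ n = (\<Sum>i=a..n - b. f $$ i * g $$ (n - i))"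
    using ab by (rule fls_times_nth_bounds)
  have R: "in_pZloc p (f $$ k - of_int (?R f k))" "in_pZloc p (g $$ k - of_int (?R g k))" for k
    using red_rat_iff[OF p f] red_rat_iff[OF p g] by blast+
  have t: "in_pZloc p (f $$ i * g $$ j - of_int (?R f i * ?R g j))" for i j
  proof -
    have "f $$ i * g $$ j - of_int (?R f i * ?R g j) =
        (f $$ i - of_int (?R f i)) * g $$ j + of_int (?R f i) * (g $$ j - of_int (?R g j))"
      by (simp add: algebra_simps)
    moreover have "in_pZloc p \<dots>"
      by (rule in_pZloc_add[OF p in_pZloc_mult_right[OF p R(1) g] in_pZloc_mult_left[OF p _ R(2)]])
        (rule in_Zloc_of_int[OF p])
    ultimately show ?thesis by simp
  qed
  let ?S = "\<Sum>i=a..n - b. ?R f i * ?R g (n - i)"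
  have "in_pZloc p (\<Sum>i=a..n - b. f $$ i * g $$ (n - i) - of_int (?R f i * ?R g (n - i)))"
    by (rule in_pZloc_sum[OF p t])
  then have "in_pZloc p ((f * g) $$ n - of_int ?S)"
    unfolding 2 by (simp add: sum_subtractf del: of_int_mult)
  moreover have "in_pZloc p (of_int (?S - ?S mod p))" using p by (simp del: of_int_diff)
  ultimately have "in_pZloc p (((f * g) $$ n - of_int ?S) + of_int (?S - ?S mod p))"
    by (rule in_pZloc_add[OF p])
  then have "in_pZloc p ((f * g) $$ n - of_int (?S mod p))" by simp
  moreover have "in_Zloc p ((f * g) $$ n)" unfolding 2 using f g p by (intro in_Zloc_sum in_Zloc_mult)
  ultimately have "red_rat p ((f * g) $$ n) = ?S mod p"
    using red_rat_iff[OF p] prime_gt_0_int[OF p] by simp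
  then show "fls_mod p (red_ser p f * red_ser p g) $$ n = red_ser p (f * g) $$ n" using 1 by simp
qed

lemma red_ser_fls_frac: "red_ser p (fls_frac f) = fls_frac (red_ser p f)"
  by (rule fls_eqI) (simp add: red_rat_def)

lemma ser_in_Zloc_fls_frac: "prime p \<Longrightarrow> ser_in_Zloc p f \<Longrightarrow> ser_in_Zloc p (fls_frac f)"
  by (simp add: ser_in_Zloc_def)

lemma ser_in_Zloc_pq: "prime p \<Longrightarrow> ser_in_Zloc p (cq a n) \<Longrightarrow> ser_in_Zloc p (pq a n)"
  by (auto simp: ser_in_Zloc_def pq_def fls_floor_def)

text \<open>Integrality of all complete quotients suffices: reducing
  \<open>cq a (Suc n) * fls_frac (cq a n) = 1\<close> shows that the reduced quotient is the
  required inverse over the residue field.\<close>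

lemma good_reductionI:
  assumes p: "prime p" and int: "\<And>n. ser_in_Zloc p (cq a n)" and nz: "\<And>n. fls_frac (cq a n) \<noteq> 0"
  shows "good_reduction p a"
proof -
  have "red_ser p (cq a n) = cq_Fp p (red_ser p a) n" for n
  proof (induction n)
    case (Suc n)
    let ?g = "cq a (Suc n)" and ?f = "fls_frac (cq a n)"
    have "?g * ?f = 1" using nz[of n] by simp
    then have "fls_mod p (red_ser p ?g * red_ser p ?f) = red_ser p 1"
      using red_ser_mult[OF p int[of "Suc n"] ser_in_Zloc_fls_frac[OF p int[of n]]] by simp
    moreover have "red_rat p 1 = 1" "red_rat p 0 = 0"
      using red_rat_iff[OF p, of 1] in_Zloc_numeral[OF p] in_pZloc_0[OF p] prime_gt_1_int[OF p]
      by (auto simp: red_rat_def)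
    then have "red_ser p 1 = 1" by (intro fls_eqI) simp
    moreover have "Fp_ser p (red_ser p ?g)"
      using red_rat_iff[OF p] int[of "Suc n"] unfolding Fp_ser_def ser_in_Zloc_def red_ser_nth by blast
    ultimately have "Fp_inverse p (red_ser p ?f) = red_ser p ?g" by (intro Fp_inverse_eqI) auto
    then show ?case using Suc.IH by (simp add: red_ser_fls_frac)
  qed simp
  then show ?thesis unfolding good_reduction_def using int by blast
qed

section \<open>Infinitely many good primes\<close>

lemma prime_factor_3_mod_4:
  fixes n :: nat
  assumes "n mod 4 = 3"
  obtains q where "prime q" "q dvd n" "q mod 4 = 3"
proof -
  have "\<exists>q. prime q \<and> q dvd n \<and> q mod 4 = 3"
    using assms
  proof (induction n rule: less_induct)
    case (less n)
    have "n \<noteq> 1" "n \<noteq> 0" using less.prems by auto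
    then obtain q where q: "prime q" "q dvd n" using prime_factor_nat by blast
    then obtain m where m: "n = q * m" by blast
    have "m < n" "m > 0" using \<open>n \<noteq> 0\<close> m prime_gt_1_nat[OF q(1)] by auto
    have "odd n" using less.prems by presburger
    then have "odd q" using m by simp
    show ?case
    proof (cases "q mod 4 = 3")
      case False
      then have "q mod 4 = 1" using \<open>odd q\<close> by presburger
      then have "m mod 4 = 3" using less.prems unfolding m by (metis mod_mult_left_eq mult_1)
      then obtain r where "prime r" "r dvd m" "r mod 4 = 3" using less.IH[OF \<open>m < n\<close>] by blast
      then show ?thesis unfolding m by (intro exI[of _ r]) auto
    qed (use q in blast)
  qed
  then show ?thesis using that by blast
qed

text \<open>Modulo such a prime, \<open>(t\<^sup>2 \<plusminus> 5) / (2t)\<close> are square roots of \<open>2\<close> and \<open>- 3\<close>.\<close>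

definition good_primes :: "int set" where
  "good_primes = {p. prime p \<and> p mod 4 = 3 \<and> p \<noteq> 3 \<and> (\<exists>t. \<not> p dvd t \<and> p dvd t^4 + 2 * t\<^sup>2 + 25)}"

lemma infinite_good_primes: "infinite good_primes"
proof
  assume fin: "finite good_primes"
  \<comment> \<open>As in Euclid's proof: \<open>t\<close> is odd and divisible by 3 and by every
    good prime. Oddness makes \<open>t^4 + 2 * t^2 + 25\<close> equal to \<open>4 * N\<close> with
    \<open>N\<close> congruent to 3 modulo 4. A prime factor of \<open>N\<close> that is 3 modulo 4
    cannot divide \<open>t\<close>, as it would then be 5.\<close>
  define t where "t = 3 * \<Prod>good_primes"
  have "odd (\<Prod>good_primes)"
    using fin by (auto simp: prime_dvd_prod_iff good_primes_def dest!: primes_dvd_imp_eq[OF two_is_prime_int])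
  then have "odd t" by (simp add: t_def)
  then obtain k where k: "t = 2 * k + 1" by (rule oddE)
  define N where "N = 4 * k^4 + 8 * k^3 + 8 * k\<^sup>2 + 4 * k + 7"
  have tN: "t^4 + 2 * t\<^sup>2 + 25 = 4 * N"
    unfolding k N_def by (simp add: power2_eq_square power3_eq_cube power4_eq_xxxx algebra_simps)
  have "t^4 + 2 * t\<^sup>2 + 25 > 0" by (simp add: add_nonneg_pos)
  then have "N > 0" unfolding tN by simp
  have "N = 4 * (k^4 + 2 * k^3 + 2 * k\<^sup>2 + k + 1) + 3" by (simp add: N_def)
  then obtain m where "N = 4 * m + 3" by blast
  then have "N mod 4 = 3" by presburger
  then have "int (nat N mod 4) = 3" using \<open>N > 0\<close> by (simp add: zmod_int)
  then have "nat N mod 4 = 3" by linarith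
  then obtain q where q: "prime q" "q dvd nat N" "q mod 4 = 3" by (rule prime_factor_3_mod_4)
  define p where "p = int q"
  have p: "prime p" "p mod 4 = 3" using q by (auto simp: p_def simp flip: of_nat_mod[of q 4, simplified])
  have "int q dvd int (nat N)" using q(2) by (simp only: of_nat_dvd_iff)
  then have "p dvd N" using \<open>N > 0\<close> by (simp add: p_def)
  then have pt: "p dvd t^4 + 2 * t\<^sup>2 + 25" unfolding tN by simp
  have nt: "\<not> p dvd t"
  proof
    assume "p dvd t"
    moreover have "t^4 + 2 * t\<^sup>2 = t * (t^3 + 2 * t)"
      by (simp add: power2_eq_square power3_eq_cube power4_eq_xxxx algebra_simps)
    ultimately have "p dvd t^4 + 2 * t\<^sup>2" by simp
    then have "p dvd 5 ^ 2" using pt by (simp add: dvd_add_right_iff)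
    then have "p dvd 5" using p(1) prime_dvd_power by blast
    then have "p = 5" using p(1) primes_dvd_imp_eq[of p 5] by simp
    then show False using p(2) by simp
  qed
  then have "p \<noteq> 3" by (auto simp: t_def)
  then have "p \<in> good_primes" using p pt nt unfolding good_primes_def by blast
  then have "p dvd t" unfolding t_def using fin by (intro dvd_mult dvd_prodI) auto
  then show False using nt by simp
qed

lemma good_primes_imp_good_prime:
  assumes "p \<in> good_primes"
  shows "\<exists>w z. good_prime p w z"
proof -
  obtain t where p: "prime p" "p mod 4 = 3" "p \<noteq> 3" and t: "\<not> p dvd t" "p dvd t^4 + 2 * t\<^sup>2 + 25"
    using assms unfolding good_primes_def by blast
  have "p \<noteq> 2" using p(2) by auto
  then have n2: "\<not> p dvd 2 * t" using p(1) t(1) primes_dvd_imp_eq[of p 2] by (auto simp: prime_dvd_mult_iff)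
  have n4: "\<not> p dvd (2 * t)\<^sup>2" using n2 p(1) prime_dvd_power by blast
  have t0: "t \<noteq> 0" using t(1) by auto
  define w z :: rat where "w = of_int (t\<^sup>2 + 5) / of_int (2 * t)" and "z = of_int (t\<^sup>2 - 5) / of_int (2 * t)"
  have "w\<^sup>2 - 2 = of_int (t^4 + 2 * t\<^sup>2 + 25) / of_int ((2 * t)\<^sup>2)"
    "z\<^sup>2 + 3 = of_int (t^4 + 2 * t\<^sup>2 + 25) / of_int ((2 * t)\<^sup>2)"
    using t0 unfolding w_def z_def by (simp_all add: field_simps power2_eq_square power4_eq_xxxx)
  then have "in_pZloc p (w\<^sup>2 - 2)" "in_pZloc p (z\<^sup>2 + 3)"
    using in_pZloc_frac_iff[OF p(1) n4] t(2) by metis+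
  moreover have "in_Zloc p w" "in_Zloc p z"
    unfolding w_def z_def in_Zloc_iff[OF p(1)] using n2 by blast+
  ultimately have "good_prime p w z" using p by unfold_locales
  then show ?thesis by blast
qed

section \<open>The continued fraction\<close>

definition fls_lin :: "rat \<Rightarrow> rat fls" where
  "fls_lin v = fls_X_inv - fls_const v"

lemma fls_lin_nonzero: "fls_lin v \<noteq> 0"
proof
  assume "fls_lin v = 0"
  then have "fls_lin v $$ (-1) = 0" by simp
  then show False by (simp add: fls_lin_def)
qed

section \<open>Division of a series by a linear polynomial\<close>

lemma fls_lin_mult_nth: "(fls_lin v * f) $$ k = f $$ (k + 1) - v * f $$ k"
  by (simp add: fls_lin_def left_diff_distrib fls_X_inv_times_conv_shift)

text \<open>The quotient satisfies \<open>f $$ k = g $$ (k - 1) + v * f $$ (k - 1)\<close> and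
  vanishes far below, so its coefficients are determined upwards.\<close>

lemma fls_lin_mult_cancel_nonpos:
  assumes "fls_lin v * f = g" "\<And>k. k < 0 \<Longrightarrow> g $$ k = 0" "k \<le> 0"
  shows "f $$ k = 0"
proof -
  obtain a where a: "\<And>k. k < a \<Longrightarrow> f $$ k = 0" using fls_zero_below by blast
  have "\<forall>k. k < a + int n \<and> k \<le> 0 \<longrightarrow> f $$ k = 0" for n
  proof (induction n)
    case (Suc n)
    show ?case
    proof (intro allI impI)
      fix k assume k: "k < a + int (Suc n) \<and> k \<le> 0"
      have "f $$ ((k - 1) + 1) - v * f $$ (k - 1) = g $$ (k - 1)"
        using assms(1) fls_lin_mult_nth by metis
      then show "f $$ k = 0" using Suc k assms(2)[of "k - 1"] by simp
    qed
  qed (use a in simp)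
  from this[of "nat (k - a + 1)"] show ?thesis using assms(3) by (cases "k < a") (auto simp: a)
qed

lemma fls_lin_mult_cancel_in_Zloc:
  assumes p: "prime p" and "fls_lin v * f = g" "ser_in_Zloc p g" "in_Zloc p v"
  shows "ser_in_Zloc p f"
proof -
  obtain a where a: "\<And>k. k < a \<Longrightarrow> f $$ k = 0" using fls_zero_below by blast
  have "\<forall>k. k < a + int n \<longrightarrow> in_Zloc p (f $$ k)" for n
  proof (induction n)
    case (Suc n)
    show ?case
    proof (intro allI impI)
      fix k assume k: "k < a + int (Suc n)"
      have "f $$ ((k - 1) + 1) - v * f $$ (k - 1) = g $$ (k - 1)"
        using assms(2) fls_lin_mult_nth by metis
      then have "f $$ k = g $$ (k - 1) + v * f $$ (k - 1)" by simp
      moreover have "in_Zloc p (f $$ (k - 1))" using Suc k by simp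
      ultimately show "in_Zloc p (f $$ k)" using assms(3,4) p
        by (auto simp: ser_in_Zloc_def intro: in_Zloc_add in_Zloc_mult)
    qed
  qed (use a p in simp)
  note bounded = this
  have "in_Zloc p (f $$ k)" for k
    using bounded[of "nat (k - a + 1)"] p by (cases "k < a") (auto simp: a)
  then show ?thesis by (simp add: ser_in_Zloc_def)
qed

definition fls_r :: "rat \<Rightarrow> rat fls" where
  "fls_r c = fls_X_inv\<^sup>2 + fls_const c"

lemma fls_r_nth: "fls_r c $$ k = (if k = -2 then 1 else 0) + (if k = 0 then c else 0)"
  by (simp add: fls_r_def)

lemma poly_ser_qpoly: "poly_ser qpoly = fls_X_inv ^ 4 + 16 * fls_X_inv\<^sup>2 + 24 * fls_X_inv + 9"
proof -
  have "degree [:9, 24, 16, 0, 1 :: rat:] = 4" by simp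
  then show ?thesis unfolding poly_ser_def qpoly_def
    by (simp add: numeral_eq_Suc atMost_Suc flip: fls_const_numeral)
qed

lemma poly_ser_minus_fls_r:
  assumes "on_curve c v" "next_c c v \<noteq> 8"
  defines "c' \<equiv> next_c c v" and "v' \<equiv> next_v c v"
  shows "poly_ser qpoly - (fls_r c')\<^sup>2 = fls_const (16 - 2 * c') * (fls_lin v * fls_lin v')"
proof -
  define K where "K = 16 - 2 * c'"
  have s: "K * (v + v') = -24" and q: "K * (v * v') = 9 - c'\<^sup>2"
    using next_sum[OF assms(1,2)] next_prod[OF assms(1,2)] unfolding K_def c'_def v'_def by auto
  have "fls_const K * (fls_lin v * fls_lin v') =
      fls_const K * fls_X_inv\<^sup>2 - fls_const (K * (v + v')) * fls_X_inv + fls_const (K * (v * v'))"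
    unfolding fls_lin_def by (simp add: algebra_simps power2_eq_square flip: fls_const_mult_const fls_plus_const)
  also have "\<dots> = poly_ser qpoly - (fls_r c')\<^sup>2"
    unfolding s q unfolding poly_ser_qpoly fls_r_def K_def
    by (simp add: algebra_simps power2_eq_square power4_eq_xxxx
      flip: fls_const_mult_const fls_minus_const fls_plus_const fls_const_numeral)
  finally show ?thesis unfolding K_def by simp
qed

abbreviation "alpha_c n \<equiv> fst (orbit (-3, 0) n)"
abbreviation "alpha_v n \<equiv> snd (orbit (-3, 0) n)"

section \<open>The expansion of \<open>sqrt D\<close> and the complete quotients of
  \<open>alpha\<close>\<close>

locale sqrt_series =
  fixes S :: "rat fls"
  assumes sq: "S\<^sup>2 = poly_ser qpoly"
    and sub: "fls_subdegree S = -2" and lead: "S $$ (-2) = 1"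
begin

lemma S_mult_nth: "poly_ser qpoly $$ (k - 2) = (\<Sum>i=-2..k. S $$ i * S $$ (k - 2 - i))"
  unfolding sq[symmetric] power2_eq_square by (subst fls_times_nth_bounds[where a = "-2" and b = "-2"]) (auto simp: sub)

text \<open>The end terms \<open>i = -2\<close> and \<open>i = k\<close> of the convolution both
  equal \<open>S $$ k\<close>; hence 2 is the only number ever divided by.\<close>

lemma S_nth_recurrence:
  assumes "k \<ge> -1"
  shows "2 * S $$ k = poly_ser qpoly $$ (k - 2) - (\<Sum>i=-1..k - 1. S $$ i * S $$ (k - 2 - i))"
proof -
  have "{-2..k} = insert (-2) (insert k {-1..k - 1})" using assms by auto
  then show ?thesis unfolding S_mult_nth using assms lead by simp
qed

lemma S_nth_minus_1: "S $$ (-1) = 0"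
  using S_nth_recurrence[of "-1"] by (simp add: poly_ser_qpoly flip: fls_const_numeral)

lemma S_in_Zloc:
  assumes p: "prime p" "p \<noteq> 2"
  shows "ser_in_Zloc p S"
proof -
  have D: "in_Zloc p (poly_ser qpoly $$ k)" for k
    unfolding poly_ser_qpoly using in_Zloc_numeral[OF p(1)] by (auto simp flip: fls_const_numeral intro!: in_Zloc_add[OF p(1)])
  have "\<not> in_pZloc p 2"
    using p primes_dvd_imp_eq[of p 2] by (auto simp: in_pZloc_numeral)
  have "in_Zloc p (S $$ k)" for k
  proof (induction "nat (k + 2)" arbitrary: k rule: less_induct)
    case less
    consider "k < -2" | "k = -2" | "k \<ge> -1" by linarith
    then show ?case
    proof cases
      case 3
      have "in_Zloc p (\<Sum>i=-1..k - 1. S $$ i * S $$ (k - 2 - i))"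
        using 3 by (intro in_Zloc_sum in_Zloc_mult p less) auto
      then have "in_Zloc p (2 * S $$ k)"
        unfolding S_nth_recurrence[OF 3] using D p by (intro in_Zloc_diff)
      then have "in_Zloc p (2 * S $$ k / 2)"
        using p \<open>\<not> in_pZloc p 2\<close> by (intro in_Zloc_divide in_Zloc_numeral)
      then show ?thesis by simp
    qed (use p lead in \<open>auto simp: sub in_Zloc_numeral\<close>)
  qed
  then show ?thesis by (simp add: ser_in_Zloc_def)
qed

text \<open>The scalars \<open>u\<close> in the denominators \<open>u * (X - v)\<close>. Consecutive
  ones multiply to the leading coefficient of \<open>D - (X^2 + c)^2\<close>, with \<open>c\<close>
  taken at the later index.\<close>

primrec alpha_u :: "nat \<Rightarrow> rat" where
  "alpha_u 0 = 1"
| "alpha_u (Suc n) = (16 - 2 * alpha_c (Suc n)) / alpha_u n"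

definition alpha :: "rat fls" where
  "alpha = (S - 3) / fls_X_inv"

definition tail :: "nat \<Rightarrow> rat fls" where
  "tail n = (S - fls_r (alpha_c (Suc n))) / (fls_const (alpha_u n) * fls_lin (alpha_v n))"

text \<open>A single good prime supplies this hypothesis, since \<open>c - 8\<close> is a unit
  there.\<close>

context
  assumes ne8: "\<And>n. alpha_c (Suc n) \<noteq> 8"
begin

lemma on_curve_alpha: "on_curve (alpha_c n) (alpha_v n)"
proof (induction n)
  case (Suc n)
  then show ?case using on_curve_next[OF Suc] ne8[of n] by simp
qed (simp add: on_curve_def quartic_def)

lemma alpha_u_nonzero: "alpha_u n \<noteq> 0"
proof (induction n)
  case (Suc n)
  have "16 - 2 * alpha_c (Suc n) \<noteq> 0" using ne8[of n] by linarith
  then show ?case using Suc by simp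
qed simp

lemma denom_nonzero: "fls_const (alpha_u n) * fls_lin (alpha_v n) \<noteq> 0"
  using alpha_u_nonzero fls_lin_nonzero by simp

text \<open>The numerator \<open>S - X^2 - c\<close> has no positive powers of \<open>X\<close>, and
  division by \<open>X - v\<close> lowers the degree once more.\<close>

lemma frac_tail: "fls_frac (tail n) = tail n"
proof -
  have "fls_lin (alpha_v n) * tail n = fls_const (1 / alpha_u n) * (S - fls_r (alpha_c (Suc n)))"
  proof -
    have "fls_const (1 / alpha_u n) * fls_const (alpha_u n) = 1" using alpha_u_nonzero[of n] by simp
    then have "fls_lin (alpha_v n) * tail n = fls_const (1 / alpha_u n) * (fls_const (alpha_u n) * fls_lin (alpha_v n) * tail n)"
      by (simp only: mult.assoc[symmetric]) simp
    also have "fls_const (alpha_u n) * fls_lin (alpha_v n) * tail n = S - fls_r (alpha_c (Suc n))"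
      unfolding tail_def using denom_nonzero by simp
    finally show ?thesis .
  qed
  moreover have "(fls_const (1 / alpha_u n) * (S - fls_r (alpha_c (Suc n)))) $$ k = 0" if "k < 0" for k
  proof -
    have "S $$ k = (if k = -2 then 1 else 0)"
      using that lead S_nth_minus_1 sub by (cases "k < -2"; cases "k = -2"; cases "k = -1") auto
    then show ?thesis using that by (simp add: fls_r_nth)
  qed
  ultimately have "tail n $$ k = 0" if "k \<le> 0" for k using fls_lin_mult_cancel_nonpos that by blast
  then show ?thesis by (intro fls_eqI) simp
qed

lemma tail_inverse:
  "tail n * ((S + fls_r (alpha_c (Suc n))) / (fls_const (alpha_u (Suc n)) * fls_lin (alpha_v (Suc n)))) = 1"
proof -
  have "(S - fls_r (alpha_c (Suc n))) * (S + fls_r (alpha_c (Suc n))) = poly_ser qpoly - (fls_r (alpha_c (Suc n)))\<^sup>2"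
    unfolding sq[symmetric] by (simp add: power2_eq_square algebra_simps)
  also have "\<dots> = fls_const (16 - 2 * alpha_c (Suc n)) * (fls_lin (alpha_v n) * fls_lin (alpha_v (Suc n)))"
    using poly_ser_minus_fls_r[OF on_curve_alpha[of n]] ne8[of n] by simp
  also have "16 - 2 * alpha_c (Suc n) = alpha_u n * alpha_u (Suc n)" using alpha_u_nonzero[of n] by simp
  finally have "(S - fls_r (alpha_c (Suc n))) * (S + fls_r (alpha_c (Suc n))) =
      (fls_const (alpha_u n) * fls_lin (alpha_v n)) * (fls_const (alpha_u (Suc n)) * fls_lin (alpha_v (Suc n)))"
    by (simp only: fls_const_mult_const[symmetric] ac_simps)
  then show ?thesis unfolding tail_def using denom_nonzero by (simp only: times_divide_times_eq divide_self mult_eq_0_iff simp_thms)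
qed

text \<open>Adding consecutive parabolas gives \<open>2 * (X + v) * (X - v)\<close>, so splitting
  the next quotient leaves the polynomial \<open>2 * (X + v) / u\<close> plus the next
  \<open>tail\<close>.\<close>

lemma frac_cq: "fls_frac (cq alpha n) = tail n"
proof (induction n)
  case 0
  \<comment> \<open>Here \<open>c = 3\<close> at index 1 cancels the constant -3 of
    \<open>alpha\<close>, so the first partial quotient is \<open>X\<close>.\<close>
  have "alpha - tail 0 = (fls_X_inv\<^sup>2) / fls_X_inv"
    unfolding alpha_def tail_def
    by (simp add: fls_lin_def fls_r_def next_c_def fls_const_numeral flip: diff_divide_distrib)
  also have "\<dots> = fls_X_inv"
    unfolding power2_eq_square by (rule nonzero_mult_div_cancel_left) simp
  finally have "alpha = fls_X_inv + tail 0" by (simp add: algebra_simps)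
  moreover have "fls_frac (fls_X_inv :: rat fls) = 0" by (intro fls_eqI) simp
  ultimately show ?case by (simp add: fls_frac_add frac_tail del: orbit.simps alpha_u.simps)
next
  case (Suc n)
  let ?c = "alpha_c (Suc n)" and ?v = "alpha_v (Suc n)" and ?u = "alpha_u (Suc n)"
  let ?d = "fls_const ?u * fls_lin ?v"
  have "cq alpha (Suc n) = (S + fls_r ?c) / ?d"
    using Suc tail_inverse[of n] by (metis cq.simps(2) inverse_unique)
  also have "\<dots> = (fls_r ?c + fls_r (alpha_c (Suc (Suc n)))) / ?d + tail (Suc n)"
    unfolding tail_def by (simp add: add_divide_distrib[symmetric] del: orbit.simps alpha_u.simps)
  also have "fls_r ?c + fls_r (alpha_c (Suc (Suc n))) = (fls_const (2 / ?u) * (fls_X_inv + fls_const ?v)) * ?d"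
  proof -
    have "fls_r ?c + fls_r (next_c ?c ?v) = fls_const 2 * ((fls_X_inv + fls_const ?v) * fls_lin ?v)"
      unfolding fls_r_def next_c_def fls_lin_def
      by (simp add: algebra_simps power2_eq_square flip: fls_const_mult_const fls_minus_const fls_plus_const del: orbit.simps)
    also have "fls_const 2 = fls_const (2 / ?u) * fls_const ?u" using alpha_u_nonzero[of "Suc n"] by simp
    finally show ?thesis by (simp add: ac_simps)
  qed
  finally have "cq alpha (Suc n) = fls_const (2 / ?u) * (fls_X_inv + fls_const ?v) + tail (Suc n)"
    using denom_nonzero[of "Suc n"] by (metis nonzero_mult_div_cancel_right)
  moreover have "fls_frac (fls_const (2 / ?u) * (fls_X_inv + fls_const ?v)) = 0" by (intro fls_eqI) simp
  ultimately show ?case by (simp only: fls_frac_add frac_tail add_0)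
qed

lemma cq_Suc: "cq alpha (Suc n) = (S + fls_r (alpha_c (Suc n))) / (fls_const (alpha_u (Suc n)) * fls_lin (alpha_v (Suc n)))"
  using frac_cq[of n] tail_inverse[of n] by (metis cq.simps(2) inverse_unique)

lemma frac_cq_nonzero: "fls_frac (cq alpha n) \<noteq> 0"
  unfolding frac_cq using tail_inverse[of n] by auto

end

lemma good_prime_alpha:
  assumes "good_prime p w z"
  shows "good_reduction p alpha \<and> (\<forall>n. ser_in_Zloc p (pq alpha n))"
proof -
  interpret good_prime p w z by (rule assms)
  have good: "in_Zloc p (alpha_c n)" "in_Zloc p (alpha_v n)" "on_curve (alpha_c n) (alpha_v n)" "minus_square (qfactor (alpha_v n))" for n
    using orbit_good[of n "alpha_c n" "alpha_v n"] by auto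
  have ne8: "alpha_c (Suc n) \<noteq> 8" for n
    using next_c_unit[OF good, of n] in_pZloc_0[OF prime] by auto
  have K: "in_Zloc p (16 - 2 * alpha_c (Suc n))" "\<not> in_pZloc p (16 - 2 * alpha_c (Suc n))" for n
    using next_K_unit[OF good, of n] good(1)[of "Suc n"] by (auto intro!: loc simp del: orbit.simps) simp
  have u: "in_Zloc p (alpha_u n) \<and> \<not> in_pZloc p (alpha_u n)" for n
  proof (induction n)
    case (Suc n)
    then have l: "in_Zloc p (alpha_u (Suc n))" using K[of n] prime by (auto intro!: in_Zloc_divide simp del: orbit.simps)
    \<comment> \<open>The product is a unit, hence so is each integral factor.\<close>
    have "alpha_u n * alpha_u (Suc n) = 16 - 2 * alpha_c (Suc n)" using alpha_u_nonzero[OF ne8, of n] by simp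
    then show ?case using l K[of n] Suc in_pZloc_mult_iff[OF prime, of "alpha_u n" "alpha_u (Suc n)"] by simp
  qed (use loc not_in_pZloc_1[OF prime] in simp)
  have S: "in_Zloc p (S $$ k)" for k using S_in_Zloc[OF prime odd_prime] by (simp add: ser_in_Zloc_def)
  have "ser_in_Zloc p (cq alpha n)" for n
  proof (cases n)
    \<comment> \<open>The numerator of \<open>alpha\<close> lacks the summand \<open>X^2\<close>
      present in all later quotients, so index 0 is separate; its denominator is
      \<open>X = fls_lin 0\<close>.\<close>
    case 0
    show ?thesis unfolding 0
    proof (rule fls_lin_mult_cancel_in_Zloc[OF prime, of 0])
      show "fls_lin 0 * cq alpha 0 = S - 3"
        by (simp del: fls_divide_X_inv add: fls_lin_def alpha_def nonzero_mult_div_cancel_left)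
      show "ser_in_Zloc p (S - 3)" using S loc
        by (auto simp: ser_in_Zloc_def simp flip: fls_const_numeral intro!: loc)
    qed (rule loc)
  next
    case (Suc m)
    show ?thesis
    proof (rule fls_lin_mult_cancel_in_Zloc[OF prime])
      let ?d = "fls_const (alpha_u n) * fls_lin (alpha_v n)"
      have "fls_const (1 / alpha_u n) * fls_const (alpha_u n) = 1" using alpha_u_nonzero[OF ne8, of n] by simp
      then have "fls_lin (alpha_v n) * cq alpha n = fls_const (1 / alpha_u n) * (?d * cq alpha n)"
        by (simp only: mult.assoc[symmetric]) simp
      also have "?d * cq alpha n = S + fls_r (alpha_c n)"
        unfolding Suc cq_Suc[OF ne8] using denom_nonzero[OF ne8, of "Suc m"] by simp
      finally show "fls_lin (alpha_v n) * cq alpha n = fls_const (1 / alpha_u n) * (S + fls_r (alpha_c n))" .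
      show "ser_in_Zloc p (fls_const (1 / alpha_u n) * (S + fls_r (alpha_c n)))"
        using S good(1)[of n] u[of n] prime unfolding ser_in_Zloc_def
        by (auto simp: fls_r_nth intro!: loc in_Zloc_divide simp del: times_divide_eq_left)
      show "in_Zloc p (alpha_v n)" by (rule good)
    qed
  qed
  then show ?thesis
    using good_reductionI[OF prime _ frac_cq_nonzero[OF ne8]] ser_in_Zloc_pq[OF prime] by blast
qed

end

theorem mainTheorem6:
  fixes sqrtD :: "rat fls"
  defines "D \<equiv> [:9, 24, 16, 0, 1:] :: rat poly"
  assumes sq: "sqrtD ^ 2 = poly_ser D"
    and lead: "fls_subdegree sqrtD = -2" "fls_nth sqrtD (-2) = 1"
  defines "\<alpha> \<equiv> (sqrtD - 3) / fls_X_inv"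
  shows "\<not> pellian D \<and>
         infinite {p :: int. prime p \<and> good_reduction p \<alpha> \<and>
                             (\<forall>n. ser_in_Zloc p (pq \<alpha> n))}"
proof -
  have D: "D = qpoly" unfolding D_def qpoly_def ..
  interpret sqrt_series sqrtD
    by unfold_locales (use sq lead D in simp_all)
  have "\<alpha> = alpha" unfolding \<alpha>_def alpha_def ..
  then have "prime p \<and> good_reduction p \<alpha> \<and> (\<forall>n. ser_in_Zloc p (pq \<alpha> n))" if "p \<in> good_primes" for p
    using good_primes_imp_good_prime[OF that] good_prime_alpha that good_primes_def by blast
  then have "good_primes \<subseteq> {p. prime p \<and> good_reduction p \<alpha> \<and> (\<forall>n. ser_in_Zloc p (pq \<alpha> n))}"
    by blast
  then show ?thesis using not_pellian_qpoly infinite_good_primes finite_subset D by blast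
qed

end
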